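(* Let $a\in\mathbb{C}^\times$, $b\in\mathbb{C}$, and let $X(z)=\frac{az}{1+bz}$. Define a linear change of variables by $$p_k(\underline q)=\sum_{m=k}^\infty c_k^m q_m,\qquad\text{where } X(z)^k=\sum_{m=k}^\infty c_k^m z^m,\quad k\ge1 .$$ Then the quadratic correction function for this change of variables can be taken to be $0$; that is, the transformation sending an arbitrary series $\Phi(\underline p)$ to the series $\Psi(\underline q)=\Phi(\underline p)\big|_{p\to p(\underline q)}$ is an automorphism of the KP hierarchy: it sends solutions to solutions.
   Context: A formal power series $\Phi(\underline p)$ in $p_1,p_2,\dots$ is called a solution of the KP hierarchy if $\tau=e^{\Phi}$, viewed as a function of $t_k=p_k/k$, is a KP tau-function, i.e. $$\operatorname{Res}_{z=\infty}dz\,e^{\xi(\underline t,z)-\xi(\underline t',z)}\tau(\{t_k-\tfrac1{kz^k}\})\tau(\{t'_k+\tfrac1{kz^k}\})=0,\qquad \xi(\underline t,z)=\sum_{k\ge1}t_kz^k;$$ similarly $\Psi(\underline q)$ is a solution if $e^\Psi$ is a KP tau-function in $t_k=q_k/k$. For a general linear change $p\mapsto p(\underline q)$ of this kind, a quadratic correction function is a quadratic form $\mathcal{Q}(\underline p)$ such that $\Phi\mapsto(\Phi+\mathcal{Q})|_{p\to p(\underline q)}$ sends solutions of KP to solutions of KP; it is not unique. *)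

theory Defs
  imports
    Complex_Main
    "HOL-Library.Multiset"
    "HOL-Library.Groups_Big_Fun"
    "HOL-Computational_Algebra.Formal_Laurent_Series"
begin

section \<open>Formal power series in arbitrarily many variables\<close>

text \<open>
  A monomial in variables indexed by \<open>'v\<close> is a finite multiset over \<open>'v\<close>: the multiset \<open>\<mu>\<close> stands
  for the product of \<open>x v\<close> over all \<open>v\<close> in \<open>\<mu>\<close>, with multiplicity. A series is an arbitrary family
  of coefficients, so infinite sums such as \<open>x 0 + x 1 + x 2 + ...\<close> are allowed.
\<close>

typedef (overloaded) ('v, 'a) mfps = "UNIV :: ('v multiset \<Rightarrow> 'a) set"
  morphisms mfps_nth Abs_mfps ..

setup_lifting type_definition_mfps

lemma mfps_nth_Abs [simp]: "mfps_nth (Abs_mfps f) \<mu> = f \<mu>"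
  by (simp add: Abs_mfps_inverse)

lemma mfps_eqI: "(\<And>\<mu>. mfps_nth F \<mu> = mfps_nth G \<mu>) \<Longrightarrow> F = G"
  by (metis ext mfps_nth_inject)

lemma finite_submultisets: "finite {\<alpha>. \<alpha> \<subseteq># (\<mu> :: 'v multiset)}"
proof (induction \<mu>)
  case empty
  show ?case by simp
next
  case (add x \<mu>)
  have "{\<alpha>. \<alpha> \<subseteq># add_mset x \<mu>} \<subseteq> {\<alpha>. \<alpha> \<subseteq># \<mu>} \<union> add_mset x ` {\<alpha>. \<alpha> \<subseteq># \<mu>}"
  proof
    fix \<alpha> assume a: "\<alpha> \<in> {\<alpha>. \<alpha> \<subseteq># add_mset x \<mu>}"
    show "\<alpha> \<in> {\<alpha>. \<alpha> \<subseteq># \<mu>} \<union> add_mset x ` {\<alpha>. \<alpha> \<subseteq># \<mu>}"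
    proof (cases "x \<in># \<alpha>")
      case True
      then obtain \<beta> where "\<alpha> = add_mset x \<beta>" by (metis mset_add)
      with a show ?thesis by auto
    next
      case False
      with a have "\<alpha> \<subseteq># \<mu>" by (auto simp: subseteq_mset_def count_eq_zero_iff) (metis le_eq_less_or_eq linorder_not_le not_in_iff zero_le)
      then show ?thesis by simp
    qed
  qed
  then show ?case using add.IH by (meson finite_UnI finite_imageI finite_subset)
qed

instantiation mfps :: (type, comm_ring_1) comm_ring_1
begin

lift_definition zero_mfps :: "('a, 'b) mfps" is "\<lambda>_. 0" .
lift_definition one_mfps :: "('a, 'b) mfps" is "\<lambda>\<mu>. if \<mu> = {#} then 1 else 0" .
lift_definition plus_mfps :: "('a, 'b) mfps \<Rightarrow> ('a, 'b) mfps \<Rightarrow> ('a, 'b) mfps"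
  is "\<lambda>f g \<mu>. f \<mu> + g \<mu>" .
lift_definition minus_mfps :: "('a, 'b) mfps \<Rightarrow> ('a, 'b) mfps \<Rightarrow> ('a, 'b) mfps"
  is "\<lambda>f g \<mu>. f \<mu> - g \<mu>" .
lift_definition uminus_mfps :: "('a, 'b) mfps \<Rightarrow> ('a, 'b) mfps"
  is "\<lambda>f \<mu>. - f \<mu>" .
lift_definition times_mfps :: "('a, 'b) mfps \<Rightarrow> ('a, 'b) mfps \<Rightarrow> ('a, 'b) mfps"
  is "\<lambda>f g \<mu>. \<Sum>\<alpha> | \<alpha> \<subseteq># \<mu>. f \<alpha> * g (\<mu> - \<alpha>)" .

instance
proof
  fix a b c :: "('a, 'b) mfps"
  show "a + b + c = a + (b + c)" by transfer (simp add: add.assoc)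
  show "a + b = b + a" by transfer (simp add: add.commute)
  show "0 + a = a" by transfer simp
  show "- a + a = 0" by transfer simp
  show "a - b = a + - b" by transfer simp
  show "(0 :: ('a, 'b) mfps) \<noteq> 1" by transfer (metis zero_neq_one)
  show "(a + b) * c = a * c + b * c" by transfer (simp add: distrib_right sum.distrib)
  show "1 * a = a"
  proof (transfer, rule ext)
    fix f :: "'a multiset \<Rightarrow> 'b" and \<mu>
    have "(\<Sum>\<alpha> | \<alpha> \<subseteq># \<mu>. (if \<alpha> = {#} then 1 else 0) * f (\<mu> - \<alpha>))
        = (\<Sum>\<alpha> | \<alpha> \<subseteq># \<mu>. if \<alpha> = {#} then f \<mu> else 0)"
      by (rule sum.cong) auto
    also have "\<dots> = f \<mu>" by (simp add: sum.delta finite_submultisets)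
    finally show "(\<Sum>\<alpha> | \<alpha> \<subseteq># \<mu>. (if \<alpha> = {#} then 1 else 0) * f (\<mu> - \<alpha>)) = f \<mu>" .
  qed
  show "a * b = b * a"
  proof (transfer, rule ext)
    fix f g :: "'a multiset \<Rightarrow> 'b" and \<mu>
    show "(\<Sum>\<alpha> | \<alpha> \<subseteq># \<mu>. f \<alpha> * g (\<mu> - \<alpha>)) = (\<Sum>\<alpha> | \<alpha> \<subseteq># \<mu>. g \<alpha> * f (\<mu> - \<alpha>))"
      by (rule sum.reindex_bij_witness[of _ "\<lambda>\<alpha>. \<mu> - \<alpha>" "\<lambda>\<alpha>. \<mu> - \<alpha>"])
         (auto simp: mult.commute subset_mset.diff_diff_right)
  qed
  show "a * b * c = a * (b * c)"
  proof (transfer, rule ext)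
    fix f g h :: "'a multiset \<Rightarrow> 'b" and \<mu>
    have "(\<Sum>\<alpha> | \<alpha> \<subseteq># \<mu>. (\<Sum>\<beta> | \<beta> \<subseteq># \<alpha>. f \<beta> * g (\<alpha> - \<beta>)) * h (\<mu> - \<alpha>))
        = (\<Sum>(\<alpha>, \<beta>) \<in> (SIGMA \<alpha>:{\<alpha>. \<alpha> \<subseteq># \<mu>}. {\<beta>. \<beta> \<subseteq># \<alpha>}). f \<beta> * g (\<alpha> - \<beta>) * h (\<mu> - \<alpha>))"
      by (simp add: sum_distrib_right sum.Sigma finite_submultisets)
    also have "\<dots> = (\<Sum>(\<beta>, \<gamma>) \<in> (SIGMA \<beta>:{\<beta>. \<beta> \<subseteq># \<mu>}. {\<gamma>. \<gamma> \<subseteq># \<mu> - \<beta>}).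
        f \<beta> * (g \<gamma> * h (\<mu> - \<beta> - \<gamma>)))"
    proof (rule sum.reindex_bij_witness[of _ "\<lambda>(\<beta>, \<gamma>). (\<beta> + \<gamma>, \<beta>)" "\<lambda>(\<alpha>, \<beta>). (\<beta>, \<alpha> - \<beta>)"],
           goal_cases)
      case (1 x)
      then show ?case by auto
    next
      case (2 x)
      then show ?case
        by (auto intro: subset_mset.order_trans simp: subseteq_mset_def diff_le_mono)
           (meson order_trans)
    next
      case (3 x)
      then show ?case by auto
    next
      case (4 x)
      then show ?case
        by (auto simp: subseteq_mset_def)
           (metis Nat.le_diff_conv2 add.commute)
    next
      case (5 x)
      then show ?case by (auto simp: mult.assoc)
    qed
    also have "\<dots> = (\<Sum>\<beta> | \<beta> \<subseteq># \<mu>. f \<beta> * (\<Sum>\<gamma> | \<gamma> \<subseteq># \<mu> - \<beta>. g \<gamma> * h (\<mu> - \<beta> - \<gamma>)))"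
      by (simp add: sum_distrib_left sum.Sigma finite_submultisets)
    finally show "(\<Sum>\<alpha> | \<alpha> \<subseteq># \<mu>. (\<Sum>\<beta> | \<beta> \<subseteq># \<alpha>. f \<beta> * g (\<alpha> - \<beta>)) * h (\<mu> - \<alpha>))
        = (\<Sum>\<beta> | \<beta> \<subseteq># \<mu>. f \<beta> * (\<Sum>\<gamma> | \<gamma> \<subseteq># \<mu> - \<beta>. g \<gamma> * h (\<mu> - \<beta> - \<gamma>)))" .
  qed
qed

end

definition mfps_const :: "'a::zero \<Rightarrow> ('v, 'a) mfps" where
  "mfps_const c = Abs_mfps (\<lambda>\<mu>. if \<mu> = {#} then c else 0)"

definition mfps_var :: "'v \<Rightarrow> ('v, 'a::zero_neq_one) mfps" where
  "mfps_var v = Abs_mfps (\<lambda>\<mu>. if \<mu> = {#v#} then 1 else 0)"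

text \<open>The possibly infinite linear form in which the variable \<open>v\<close> has coefficient \<open>l v\<close>.\<close>

definition mfps_linear :: "('v \<Rightarrow> 'a::zero) \<Rightarrow> ('v, 'a) mfps" where
  "mfps_linear l = Abs_mfps (\<lambda>\<mu>. if size \<mu> = 1 then l (THE v. \<mu> = {#v#}) else 0)"

text \<open>
  The exponential of a series without constant term. The powers \<open>F ^ n\<close> with \<open>n > size \<mu>\<close> do not
  contribute to the coefficient at \<open>\<mu>\<close>.
\<close>

definition mfps_exp0 :: "('v, 'a::field_char_0) mfps \<Rightarrow> ('v, 'a) mfps" where
  "mfps_exp0 F = Abs_mfps (\<lambda>\<mu>. \<Sum>n\<le>size \<mu>. mfps_nth (F ^ n) \<mu> / fact n)"

definition mfps_exp :: "('v, complex) mfps \<Rightarrow> ('v, complex) mfps" where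
  "mfps_exp F = (let c = mfps_nth F {#} in mfps_const (exp c) * mfps_exp0 (F - mfps_const c))"

text \<open>
  Substitution of the series \<open>g v\<close> for each variable \<open>v\<close> of \<open>F\<close>. \<open>Sum_any\<close> is the sum over
  the monomials \<open>l\<close> with a nonzero term, and is 0 if there are infinitely many of them. They are
  finitely many, whatever \<open>F\<close> is, as soon as no \<open>g v\<close> has a constant term and each monomial occurs
  in only finitely many of the \<open>g v\<close>. This holds for the shifts and the rescaling below and for the
  substitution of \<open>p\<^sub>k(q)\<close> when \<open>X(0) = 0\<close>.
\<close>

definition mfps_subst ::
    "('v \<Rightarrow> ('w, 'a::comm_ring_1) mfps) \<Rightarrow> ('v, 'a) mfps \<Rightarrow> ('w, 'a) mfps" where
  "mfps_subst g F =
     Abs_mfps (\<lambda>\<mu>. Sum_any (\<lambda>l. mfps_nth F l * mfps_nth (\<Prod>v\<in>#l. g v) \<mu>))"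


section \<open>The KP hierarchy\<close>

text \<open>
  Indexing convention: the variable with index \<open>i :: nat\<close> is the one the literature numbers
  \<open>k = Suc i\<close>. So \<open>(nat, complex) mfps\<close> is the ring of series in \<open>p\<^sub>1, p\<^sub>2, ...\<close> (or in
  \<open>t\<^sub>1, t\<^sub>2, ...\<close>). Series in two sets of times \<open>t\<close>, \<open>t'\<close> use the index type \<open>nat + nat\<close>.

  Laurent series in the local parameter \<open>w = 1/z\<close> at \<open>z = \<infinity>\<close> are rendered by \<open>complex fls\<close>:
  \<open>fls_X\<close> is \<open>w\<close> and \<open>fls_X_inv\<close> is \<open>z\<close>, and \<open>dz = (dz/dw) dw\<close>.
\<close>

definition residue_infinity :: "complex fls \<Rightarrow> complex" where
  "residue_infinity f = fls_residue (f * fls_deriv fls_X_inv)"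

text \<open>
  Reads a series in the variables \<open>Some v\<close> and \<open>None\<close> as a series in the variables \<open>v\<close> whose
  coefficients are power series in \<open>w\<close>, where \<open>None\<close> stands for \<open>w\<close>.
\<close>

definition collect_w :: "('v option, complex) mfps \<Rightarrow> ('v, complex fls) mfps" where
  "collect_w F = Abs_mfps (\<lambda>\<mu>. fps_to_fls (Abs_fps (\<lambda>n.
     mfps_nth F (image_mset Some \<mu> + replicate_mset n None))))"

text \<open>\<open>exp (\<xi>(t,z) - \<xi>(t',z))\<close>, where \<open>\<xi>(t,z)\<close> is the sum of all \<open>t\<^sub>k z\<^sup>k\<close>, \<open>k \<ge> 1\<close>\<close>

definition kp_exp :: "(nat + nat, complex fls) mfps" where
  "kp_exp = mfps_exp0 (mfps_linear (\<lambda>v. case v of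
      Inl i \<Rightarrow> fls_X_inv ^ Suc i
    | Inr i \<Rightarrow> - (fls_X_inv ^ Suc i)))"

text \<open>\<open>\<tau>(t\<^sub>k - 1/(k z\<^sup>k))\<close> and \<open>\<tau>(t'\<^sub>k + 1/(k z\<^sup>k))\<close>\<close>

definition kp_shift_minus :: "(nat, complex) mfps \<Rightarrow> (nat + nat, complex fls) mfps" where
  "kp_shift_minus \<tau> = collect_w (mfps_subst (\<lambda>i.
     mfps_var (Some (Inl i)) - mfps_const (1 / of_nat (Suc i)) * mfps_var None ^ Suc i) \<tau>)"

definition kp_shift_plus :: "(nat, complex) mfps \<Rightarrow> (nat + nat, complex fls) mfps" where
  "kp_shift_plus \<tau> = collect_w (mfps_subst (\<lambda>i.
     mfps_var (Some (Inr i)) + mfps_const (1 / of_nat (Suc i)) * mfps_var None ^ Suc i) \<tau>)"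

text \<open>The bilinear identity is an identity of series in \<open>t\<close> and \<open>t'\<close>, hence one per monomial.\<close>

definition kp_tau :: "(nat, complex) mfps \<Rightarrow> bool" where
  "kp_tau \<tau> \<longleftrightarrow>
     (\<forall>\<mu>. residue_infinity (mfps_nth (kp_exp * kp_shift_minus \<tau> * kp_shift_plus \<tau>) \<mu>) = 0)"

text \<open>\<open>\<Phi>\<close> is a series in \<open>p\<close>, and \<open>t\<^sub>k = p\<^sub>k / k\<close>, that is, \<open>p\<^sub>k = k t\<^sub>k\<close>.\<close>

definition kp_solution :: "(nat, complex) mfps \<Rightarrow> bool" where
  "kp_solution \<Phi> \<longleftrightarrow>
     kp_tau (mfps_subst (\<lambda>i. mfps_const (of_nat (Suc i)) * mfps_var i) (mfps_exp \<Phi>))"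

text \<open>
  A transformation of series is an automorphism of the hierarchy if it is invertible and it and its
  inverse send solutions to solutions.
\<close>

definition kp_automorphism :: "((nat, complex) mfps \<Rightarrow> (nat, complex) mfps) \<Rightarrow> bool" where
  "kp_automorphism T \<longleftrightarrow> bij T \<and> (\<forall>\<Phi>. kp_solution (T \<Phi>) \<longleftrightarrow> kp_solution \<Phi>)"


section \<open>Linear changes of variables and quadratic corrections\<close>

text \<open>
  \<open>p\<^sub>k(q)\<close> is the sum of all \<open>c k m * q\<^sub>m\<close> where \<open>c k m\<close> is the coefficient of \<open>z\<^sup>m\<close> in \<open>X(z)\<^sup>k\<close>.
  For \<open>X\<close> with zero constant term, \<open>c k m = 0\<close> unless \<open>m \<ge> k\<close>.
\<close>

definition power_change :: "complex fps \<Rightarrow> nat \<Rightarrow> (nat, complex) mfps" where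
  "power_change X i = mfps_linear (\<lambda>j. fps_nth (X ^ Suc i) (Suc j))"

definition quadratic_form :: "('v, 'a::zero) mfps \<Rightarrow> bool" where
  "quadratic_form Q \<longleftrightarrow> (\<forall>\<mu>. mfps_nth Q \<mu> \<noteq> 0 \<longrightarrow> size \<mu> = 2)"

definition quadratic_correction ::
    "(nat \<Rightarrow> (nat, complex) mfps) \<Rightarrow> (nat, complex) mfps \<Rightarrow> bool" where
  "quadratic_correction p Q \<longleftrightarrow>
     quadratic_form Q \<and> (\<forall>\<Phi>. kp_solution \<Phi> \<longrightarrow> kp_solution (mfps_subst p (\<Phi> + Q)))"

end

theory Submission
  imports Defs
begin

text \<open>
  In the variables \<open>p\<^sub>k = k t\<^sub>k\<close> and \<open>w = 1/z\<close>, the shifts of the bilinear identity are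
  \<open>p\<^sub>k \<mapsto> p\<^sub>k - w\<^sup>k\<close> and \<open>p'\<^sub>k \<mapsto> p'\<^sub>k + w\<^sup>k\<close>. The change of variables turns the shift of \<open>q\<close> by \<open>w\<close>
  into the shift of \<open>p\<close> by \<open>X(w)\<close>, and \<open>1/X(w) = (z + b)/a\<close> is affine in \<open>z\<close>, so that passing from
  \<open>w\<close> to \<open>X(w)\<close> multiplies residues at infinity by the constant \<open>a\<close>. The exponent is nearly preserved:
  with \<open>y = 1/X(w)\<close> one has \<open>1 - y X(s) = (1 - z s)/(1 + b s)\<close>, and the logarithm of this identity shows
  that \<open>\<xi>(t, y)\<close> becomes \<open>\<xi>(t, z)\<close> plus a linear form in \<open>t\<close> that does not involve \<open>z\<close>. Hence the
  bilinear identity in \<open>q\<close> is, up to an invertible factor independent of \<open>z\<close>, the one in \<open>p\<close> with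
  \<open>w\<close> replaced by \<open>X(w)\<close>. The inverse change of variables comes from the compositional inverse of \<open>X\<close>,
  which has the same shape.
\<close>

section \<open>Coefficients, order and exponential\<close>

lemmas mfps_nth_zero [simp] = zero_mfps.rep_eq
lemmas mfps_nth_one = one_mfps.rep_eq
lemmas mfps_nth_add [simp] = plus_mfps.rep_eq
lemmas mfps_nth_diff [simp] = minus_mfps.rep_eq
lemmas mfps_nth_minus [simp] = uminus_mfps.rep_eq
lemmas mfps_nth_mult = times_mfps.rep_eq

lemma mfps_nth_sum: "mfps_nth (sum f A) \<mu> = (\<Sum>x\<in>A. mfps_nth (f x) \<mu>)"
  by (induction A rule: infinite_finite_induct) auto

lemma mfps_nth_const: "mfps_nth (mfps_const c) \<mu> = (if \<mu> = {#} then c else 0)"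
  by (simp add: mfps_const_def)

lemma mfps_nth_var: "mfps_nth (mfps_var v) \<mu> = (if \<mu> = {#v#} then 1 else 0)"
  by (simp add: mfps_var_def)

lemma mfps_nth_linear_single [simp]: "mfps_nth (mfps_linear l) {#v#} = l v"
  by (simp add: mfps_linear_def)

lemma mfps_nth_linear_size: "size \<mu> \<noteq> 1 \<Longrightarrow> mfps_nth (mfps_linear l) \<mu> = 0"
  by (simp add: mfps_linear_def)

lemma mfps_linear_eqI:
  assumes "\<And>\<mu>. size \<mu> \<noteq> 1 \<Longrightarrow> mfps_nth F \<mu> = 0" and "\<And>v. mfps_nth F {#v#} = l v"
  shows "F = mfps_linear l"
proof (rule mfps_eqI)
  fix \<mu> show "mfps_nth F \<mu> = mfps_nth (mfps_linear l) \<mu>"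
  proof (cases "size \<mu> = 1")
    case True
    then obtain v where "\<mu> = {#v#}" using size_1_singleton_mset by blast
    then show ?thesis by (simp add: assms)
  qed (simp add: assms mfps_nth_linear_size)
qed

lemma mfps_linear_delta: "mfps_linear (\<lambda>w. if w = v then 1 else 0) = mfps_var v"
  by (rule mfps_linear_eqI[symmetric]) (auto simp: mfps_nth_var)

lemma mfps_linear_add: "mfps_linear (\<lambda>v. f v + g v) = mfps_linear f + mfps_linear (g :: 'v \<Rightarrow> 'a::comm_ring_1)"
  by (rule mfps_linear_eqI[symmetric]) (auto simp: mfps_nth_linear_size)

lemma mfps_linear_minus: "mfps_linear (\<lambda>v. - f v) = - mfps_linear (f :: 'v \<Rightarrow> 'a::comm_ring_1)"
  by (rule mfps_linear_eqI[symmetric]) (auto simp: mfps_nth_linear_size)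

lemma mfps_nth_const_mult [simp]: "mfps_nth (mfps_const c * F) \<mu> = c * mfps_nth F \<mu>"
proof -
  have "mfps_nth (mfps_const c * F) \<mu> = (\<Sum>\<alpha> | \<alpha> \<subseteq># \<mu>. if \<alpha> = {#} then c * mfps_nth F \<mu> else 0)"
    unfolding mfps_nth_mult by (rule sum.cong) (auto simp: mfps_nth_const)
  then show ?thesis by (simp add: finite_submultisets)
qed

lemma mfps_const_1: "mfps_const 1 = 1"
  by (rule mfps_eqI) (simp add: mfps_nth_const mfps_nth_one)

lemma mfps_const_mult: "mfps_const (x * y) = mfps_const x * mfps_const (y :: 'a::comm_ring_1)"
  by (rule mfps_eqI) (simp add: mfps_nth_const)

lemma mfps_const_power: "mfps_const (x ^ n) = mfps_const (x :: 'a::comm_ring_1) ^ n"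
  by (induction n) (auto simp: mfps_const_1 mfps_const_mult)

lemma mfps_nth_mult_empty [simp]: "mfps_nth (F * G) {#} = mfps_nth F {#} * mfps_nth G {#}"
  by (simp add: mfps_nth_mult)

lemma mfps_nth_mult_nonzeroE:
  assumes "mfps_nth (F * G) \<mu> \<noteq> 0"
  obtains \<alpha> where "\<alpha> \<subseteq># \<mu>" "mfps_nth F \<alpha> \<noteq> 0" "mfps_nth G (\<mu> - \<alpha>) \<noteq> 0"
proof -
  obtain \<alpha> where "\<alpha> \<in> {\<alpha>. \<alpha> \<subseteq># \<mu>}" "mfps_nth F \<alpha> * mfps_nth G (\<mu> - \<alpha>) \<noteq> 0"
    using assms sum.not_neutral_contains_not_neutral unfolding mfps_nth_mult by blast
  then show ?thesis by (intro that[of \<alpha>]) auto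
qed

lemma mfps_nth_var_mult:
  "mfps_nth (mfps_var v * F) \<mu> = (if v \<in># \<mu> then mfps_nth F (\<mu> - {#v#}) else 0)"
proof -
  have "mfps_nth (mfps_var v * F) \<mu> =
      (\<Sum>\<alpha> | \<alpha> \<subseteq># \<mu>. if \<alpha> = {#v#} then mfps_nth F (\<mu> - {#v#}) else 0)"
    unfolding mfps_nth_mult by (rule sum.cong) (auto simp: mfps_nth_var)
  then show ?thesis by (simp add: finite_submultisets)
qed

lemma mfps_nth_var_power:
  "mfps_nth (mfps_var v ^ n) \<mu> = (if \<mu> = replicate_mset n v then 1 else (0 :: 'a::comm_ring_1))"
proof (induction n arbitrary: \<mu>)
  case (Suc n)
  have "v \<in># \<mu> \<and> \<mu> - {#v#} = replicate_mset n v \<longleftrightarrow> \<mu> = replicate_mset (Suc n) v"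
    by (metis add_mset_remove_trivial insert_DiffM replicate_mset_Suc union_single_eq_member)
  then show ?case by (auto simp: mfps_nth_var_mult Suc.IH)
qed (simp add: mfps_nth_one)

section \<open>Filtration by total degree, and the exponential law\<close>

definition mfps_order_ge :: "nat \<Rightarrow> ('v, 'a::comm_ring_1) mfps \<Rightarrow> bool" where
  "mfps_order_ge n F \<longleftrightarrow> (\<forall>\<mu>. size \<mu> < n \<longrightarrow> mfps_nth F \<mu> = 0)"

lemma mfps_order_ge_1_iff: "mfps_order_ge 1 F \<longleftrightarrow> mfps_nth F {#} = 0"
  by (auto simp: mfps_order_ge_def)

lemma mfps_order_ge_linear [simp]: "mfps_order_ge 1 (mfps_linear l)"
  by (simp add: mfps_order_ge_def mfps_nth_linear_size)

lemma mfps_order_ge_mult: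
  assumes "mfps_order_ge m F" "mfps_order_ge n G"
  shows "mfps_order_ge (m + n) (F * G)"
  unfolding mfps_order_ge_def
proof (intro allI impI, rule ccontr)
  fix \<mu> assume "size \<mu> < m + n" "mfps_nth (F * G) \<mu> \<noteq> 0"
  from this(2) obtain \<alpha> where \<alpha>: "\<alpha> \<subseteq># \<mu>" "mfps_nth F \<alpha> \<noteq> 0" "mfps_nth G (\<mu> - \<alpha>) \<noteq> 0"
    by (rule mfps_nth_mult_nonzeroE)
  then have "m \<le> size \<alpha>" "n \<le> size (\<mu> - \<alpha>)"
    using assms by (meson mfps_order_ge_def not_le)+
  moreover have "size (\<mu> - \<alpha>) = size \<mu> - size \<alpha>" "size \<alpha> \<le> size \<mu>"
    using \<alpha>(1) by (simp_all add: size_Diff_submset size_mset_mono)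
  ultimately show False using \<open>size \<mu> < m + n\<close> by linarith
qed

lemma mfps_order_ge_power: "mfps_order_ge 1 F \<Longrightarrow> mfps_order_ge n (F ^ n)"
proof (induction n)
  case (Suc n)
  then show ?case using mfps_order_ge_mult[of 1 F n "F ^ n"] by simp
qed (simp add: mfps_order_ge_def)

text \<open>The truncation in \<open>mfps_exp0\<close> depends on the monomial. Any larger bound
  gives the same coefficient, because \<open>F ^ n\<close> has order at least n; a common bound
  allows sums at different monomials to be interchanged.\<close>

lemma mfps_nth_exp0:
  assumes "mfps_order_ge 1 F" "size \<mu> \<le> N"
  shows "mfps_nth (mfps_exp0 F) \<mu> = (\<Sum>n\<le>N. mfps_nth (F ^ n) \<mu> / fact n)"
  unfolding mfps_exp0_def mfps_nth_Abs
proof (rule sum.mono_neutral_left)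
  show "\<forall>n\<in>{..N} - {..size \<mu>}. mfps_nth (F ^ n) \<mu> / fact n = 0"
    using mfps_order_ge_power[OF assms(1)] by (auto simp: mfps_order_ge_def)
qed (use assms in auto)

text \<open>The binomial theorem splits the n-th term into the products of \<open>F ^ i / i!\<close>
  and \<open>G ^ j / j!\<close> with i + j = n. At a fixed monomial only finitely many pairs (i, j)
  matter.\<close>

lemma mfps_exp0_add:
  fixes F G :: "('v, 'a::field_char_0) mfps"
  assumes F: "mfps_order_ge 1 F" and G: "mfps_order_ge 1 G"
  shows "mfps_exp0 (F + G) = mfps_exp0 F * mfps_exp0 G"
proof (rule mfps_eqI)
  fix \<mu> :: "'v multiset"
  define N where "N = size \<mu>"
  define c :: "nat \<Rightarrow> nat \<Rightarrow> 'a" where "c i j = mfps_nth (F ^ i * G ^ j) \<mu> / (fact i * fact j)" for i j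
  have FG: "mfps_order_ge 1 (F + G)" using F G unfolding mfps_order_ge_1_iff by simp
  have c0: "c i j = 0" if "i + j > N" for i j
    using mfps_order_ge_mult[OF mfps_order_ge_power[OF F, of i] mfps_order_ge_power[OF G, of j]] that
    by (simp add: mfps_order_ge_def c_def N_def)
  have "mfps_nth ((F + G) ^ n) \<mu> / fact n = (\<Sum>i\<le>n. c i (n - i))" for n
  proof -
    have "mfps_nth (of_nat k * H) \<mu> = of_nat k * mfps_nth H \<mu>" for k and H :: "('v, 'a) mfps"
      by (induction k) (auto simp: algebra_simps)
    then have "mfps_nth ((F + G) ^ n) \<mu> = (\<Sum>i\<le>n. of_nat (n choose i) * mfps_nth (F ^ i * G ^ (n - i)) \<mu>)"
      by (simp add: binomial_ring mfps_nth_sum mult.assoc)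
    then show ?thesis
      by (auto simp: sum_divide_distrib c_def binomial_fact field_simps intro!: sum.cong)
  qed
  then have "mfps_nth (mfps_exp0 (F + G)) \<mu> = (\<Sum>n\<le>N. \<Sum>i\<le>n. c i (n - i))"
    by (simp add: mfps_nth_exp0[OF FG, of \<mu> N] N_def)
  also have "\<dots> = (\<Sum>(i, j)\<in>{(i, j). i + j \<le> N}. c i j)"
    by (simp add: sum.triangle_reindex_eq)
  \<comment> \<open>The triangle may be enlarged to a square, on which the sums separate:
    \<open>F ^ i * G ^ j\<close> has order at least i + j.\<close>
  also have "\<dots> = (\<Sum>(i, j)\<in>{..N} \<times> {..N}. c i j)"
    by (rule sum.mono_neutral_left) (auto intro!: c0)
  also have "\<dots> = (\<Sum>i\<le>N. \<Sum>j\<le>N. c i j)"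
    by (simp add: sum.cartesian_product)
  also have "\<dots> = (\<Sum>i\<le>N. \<Sum>j\<le>N. \<Sum>\<alpha> | \<alpha> \<subseteq># \<mu>.
      (mfps_nth (F ^ i) \<alpha> / fact i) * (mfps_nth (G ^ j) (\<mu> - \<alpha>) / fact j))"
    by (simp add: c_def mfps_nth_mult sum_divide_distrib)
  also have "\<dots> = (\<Sum>i\<le>N. \<Sum>\<alpha> | \<alpha> \<subseteq># \<mu>. \<Sum>j\<le>N.
      (mfps_nth (F ^ i) \<alpha> / fact i) * (mfps_nth (G ^ j) (\<mu> - \<alpha>) / fact j))"
    by (intro sum.cong refl sum.swap)
  also have "\<dots> = (\<Sum>\<alpha> | \<alpha> \<subseteq># \<mu>. \<Sum>i\<le>N. \<Sum>j\<le>N.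
      (mfps_nth (F ^ i) \<alpha> / fact i) * (mfps_nth (G ^ j) (\<mu> - \<alpha>) / fact j))"
    by (rule sum.swap)
  also have "\<dots> = (\<Sum>\<alpha> | \<alpha> \<subseteq># \<mu>. mfps_nth (mfps_exp0 F) \<alpha> * mfps_nth (mfps_exp0 G) (\<mu> - \<alpha>))"
  proof (rule sum.cong)
    fix \<alpha> assume "\<alpha> \<in> {\<alpha>. \<alpha> \<subseteq># \<mu>}"
    then have "size \<alpha> \<le> N" "size (\<mu> - \<alpha>) \<le> N"
      by (simp_all add: N_def size_mset_mono)
    then show "(\<Sum>i\<le>N. \<Sum>j\<le>N. (mfps_nth (F ^ i) \<alpha> / fact i) * (mfps_nth (G ^ j) (\<mu> - \<alpha>) / fact j)) =
        mfps_nth (mfps_exp0 F) \<alpha> * mfps_nth (mfps_exp0 G) (\<mu> - \<alpha>)"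
      using F G by (simp only: mfps_nth_exp0 sum_product)
  qed simp
  finally show "mfps_nth (mfps_exp0 (F + G)) \<mu> = mfps_nth (mfps_exp0 F * mfps_exp0 G) \<mu>"
    by (simp add: mfps_nth_mult)
qed

section \<open>Substitution\<close>

text \<open>The first condition bounds the degree of the monomials that contribute to a given
  coefficient, the second leaves finitely many variables to build them from.\<close>

definition mfps_substitutable :: "('v \<Rightarrow> ('w, 'a::comm_ring_1) mfps) \<Rightarrow> bool" where
  "mfps_substitutable g \<longleftrightarrow>
     (\<forall>v. mfps_nth (g v) {#} = 0) \<and> (\<forall>\<mu>. finite {v. mfps_nth (g v) \<mu> \<noteq> 0})"

text \<open>Does not depend on the series substituted into, so one finite index set serves all of
  them at once.\<close>

definition subst_support :: "('v \<Rightarrow> ('w, 'a::comm_ring_1) mfps) \<Rightarrow> 'w multiset \<Rightarrow> 'v multiset set" where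
  "subst_support g \<mu> = {l. mfps_nth (\<Prod>v\<in>#l. g v) \<mu> \<noteq> 0}"

lemma finite_multisets_size_le:
  assumes "finite A"
  shows "finite {l. set_mset l \<subseteq> A \<and> size l \<le> n}"
proof (rule finite_subset)
  show "{l. set_mset l \<subseteq> A \<and> size l \<le> n} \<subseteq> mset ` {xs. set xs \<subseteq> A \<and> length xs \<le> n}"
  proof
    fix l assume l: "l \<in> {l. set_mset l \<subseteq> A \<and> size l \<le> n}"
    obtain xs where "mset xs = l" by (metis ex_mset)
    with l show "l \<in> mset ` {xs. set xs \<subseteq> A \<and> length xs \<le> n}" by auto
  qed
qed (use assms finite_lists_length_le in blast)

text \<open>Each factor \<open>g v\<close> uses up a nonempty part of \<mu>, since it has no
  constant term. So there are at most \<open>size \<mu>\<close> factors, and each variable is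
  witnessed by some submultiset of \<mu>.\<close>

lemma subst_support_bound:
  assumes g: "\<And>v. mfps_nth (g v) {#} = 0" and "l \<in> subst_support g \<mu>"
  shows "size l \<le> size \<mu> \<and> set_mset l \<subseteq> (\<Union>\<alpha>\<in>{\<alpha>. \<alpha> \<subseteq># \<mu>}. {v. mfps_nth (g v) \<alpha> \<noteq> 0})"
  using assms(2)
proof (induction l arbitrary: \<mu>)
  case (add v l)
  then have "mfps_nth (g v * (\<Prod>v\<in>#l. g v)) \<mu> \<noteq> 0"
    by (simp add: subst_support_def)
  then obtain \<alpha> where \<alpha>: "\<alpha> \<subseteq># \<mu>" "mfps_nth (g v) \<alpha> \<noteq> 0" "mfps_nth (\<Prod>v\<in>#l. g v) (\<mu> - \<alpha>) \<noteq> 0"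
    by (rule mfps_nth_mult_nonzeroE)
  have IH: "size l \<le> size (\<mu> - \<alpha>)"
    "set_mset l \<subseteq> (\<Union>\<beta>\<in>{\<beta>. \<beta> \<subseteq># \<mu> - \<alpha>}. {v. mfps_nth (g v) \<beta> \<noteq> 0})"
    using add.IH[of "\<mu> - \<alpha>"] \<alpha>(3) by (simp_all add: subst_support_def)
  have "\<alpha> \<noteq> {#}" using g \<alpha>(2) by metis
  then have "0 < size \<alpha>" by (simp add: nonempty_has_size)
  then have "size (add_mset v l) \<le> size \<mu>"
    using IH(1) size_Diff_submset[OF \<alpha>(1)] size_mset_mono[OF \<alpha>(1)] by simp
  moreover have "\<beta> \<subseteq># \<mu> - \<alpha> \<Longrightarrow> \<beta> \<subseteq># \<mu>" for \<beta>
    by (meson diff_subset_eq_self subset_mset.order_trans)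
  ultimately show ?case using IH(2) \<alpha>(1,2) by fastforce
qed simp

lemma finite_subst_support:
  assumes "mfps_substitutable g"
  shows "finite (subst_support g \<mu>)"
proof (rule finite_subset)
  let ?A = "\<Union>\<alpha>\<in>{\<alpha>. \<alpha> \<subseteq># \<mu>}. {v. mfps_nth (g v) \<alpha> \<noteq> 0}"
  show "subst_support g \<mu> \<subseteq> {l. set_mset l \<subseteq> ?A \<and> size l \<le> size \<mu>}"
    using assms subst_support_bound[of g _ \<mu>] unfolding mfps_substitutable_def by blast
  show "finite {l. set_mset l \<subseteq> ?A \<and> size l \<le> size \<mu>}"
    using assms by (intro finite_multisets_size_le finite_UN_I finite_submultisets)
      (auto simp: mfps_substitutable_def)
qed

lemma size_le_if_subst_support:
  assumes "mfps_substitutable g" "l \<in> subst_support g \<mu>"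
  shows "size l \<le> size \<mu>"
  using subst_support_bound[OF _ assms(2)] assms(1) by (auto simp: mfps_substitutable_def)

text \<open>The free choice of \<open>A\<close> lets several supports be enlarged to a common index
  set.\<close>

lemma mfps_nth_subst:
  assumes "finite A" "subst_support g \<mu> \<subseteq> A"
  shows "mfps_nth (mfps_subst g F) \<mu> = (\<Sum>l\<in>A. mfps_nth F l * mfps_nth (\<Prod>v\<in>#l. g v) \<mu>)"
  unfolding mfps_subst_def mfps_nth_Abs
  by (rule Sum_any.expand_superset) (use assms in \<open>auto simp: subst_support_def\<close>)

lemma mfps_nth_subst_support:
  assumes "mfps_substitutable g"
  shows "mfps_nth (mfps_subst g F) \<mu> =
    (\<Sum>l\<in>subst_support g \<mu>. mfps_nth F l * mfps_nth (\<Prod>v\<in>#l. g v) \<mu>)"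
  by (rule mfps_nth_subst) (simp_all add: finite_subst_support assms)

context
  fixes g :: "'v \<Rightarrow> ('w, 'a::comm_ring_1) mfps"
  assumes g: "mfps_substitutable g"
begin

lemma mfps_subst_add: "mfps_subst g (F + G) = mfps_subst g F + mfps_subst g G"
  by (rule mfps_eqI) (simp add: mfps_nth_subst_support[OF g] algebra_simps sum.distrib)

lemma mfps_subst_diff: "mfps_subst g (F - G) = mfps_subst g F - mfps_subst g G"
  by (rule mfps_eqI) (simp add: mfps_nth_subst_support[OF g] algebra_simps sum_subtractf)

lemma mfps_subst_const: "mfps_subst g (mfps_const c) = mfps_const c"
proof (rule mfps_eqI)
  fix \<mu>
  have "mfps_nth (mfps_subst g (mfps_const c)) \<mu> =
      (\<Sum>l\<in>insert {#} (subst_support g \<mu>). mfps_nth (mfps_const c) l * mfps_nth (\<Prod>v\<in>#l. g v) \<mu>)"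
    by (rule mfps_nth_subst) (use g finite_subst_support in auto)
  also have "\<dots> = (\<Sum>l\<in>insert {#} (subst_support g \<mu>). if l = {#} then c * mfps_nth 1 \<mu> else 0)"
    by (rule sum.cong) (auto simp: mfps_nth_const)
  also have "\<dots> = mfps_nth (mfps_const c) \<mu>"
    by (simp add: finite_subst_support g mfps_nth_const mfps_nth_one)
  finally show "mfps_nth (mfps_subst g (mfps_const c)) \<mu> = mfps_nth (mfps_const c) \<mu>" .
qed

lemma mfps_subst_1: "mfps_subst g 1 = 1"
  using mfps_subst_const[of 1] by (simp add: mfps_const_1)

text \<open>A linear form may be an infinite sum of variables, so finite additivity does not give
  this; at a fixed \<mu> only the singleton monomials from \<open>A\<close> survive.\<close>

lemma mfps_subst_linear:
  assumes "finite A" "{v. mfps_nth (g v) \<mu> \<noteq> 0} \<subseteq> A"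
  shows "mfps_nth (mfps_subst g (mfps_linear f)) \<mu> = (\<Sum>v\<in>A. f v * mfps_nth (g v) \<mu>)"
proof -
  have "mfps_nth (mfps_subst g (mfps_linear f)) \<mu> =
      (\<Sum>l\<in>subst_support g \<mu> \<union> (\<lambda>v. {#v#}) ` A.
         mfps_nth (mfps_linear f) l * mfps_nth (\<Prod>v\<in>#l. g v) \<mu>)"
    by (rule mfps_nth_subst) (use g finite_subst_support assms in auto)
  also have "\<dots> = (\<Sum>l\<in>(\<lambda>v. {#v#}) ` A.
         mfps_nth (mfps_linear f) l * mfps_nth (\<Prod>v\<in>#l. g v) \<mu>)"
  proof (rule sum.mono_neutral_right)
    show "\<forall>l\<in>subst_support g \<mu> \<union> (\<lambda>v. {#v#}) ` A - (\<lambda>v. {#v#}) ` A.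
        mfps_nth (mfps_linear f) l * mfps_nth (\<Prod>v\<in>#l. g v) \<mu> = 0"
    proof
      fix l assume l: "l \<in> subst_support g \<mu> \<union> (\<lambda>v. {#v#}) ` A - (\<lambda>v. {#v#}) ` A"
      show "mfps_nth (mfps_linear f) l * mfps_nth (\<Prod>v\<in>#l. g v) \<mu> = 0"
      proof (cases "size l = 1")
        case True
        then obtain v where "l = {#v#}" using size_1_singleton_mset by blast
        with l have "v \<notin> A" by blast
        with assms(2) have "mfps_nth (g v) \<mu> = 0" by blast
        with \<open>l = {#v#}\<close> show ?thesis by simp
      qed (simp add: mfps_nth_linear_size)
    qed
  qed (use g finite_subst_support assms in auto)
  also have "\<dots> = (\<Sum>v\<in>A. f v * mfps_nth (g v) \<mu>)"
    by (subst sum.reindex) (auto simp: inj_on_def)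
  finally show ?thesis .
qed

lemma mfps_subst_var: "mfps_subst g (mfps_var v) = g v"
proof (rule mfps_eqI)
  fix \<mu>
  have "mfps_nth (mfps_subst g (mfps_var v)) \<mu> =
      (\<Sum>w\<in>insert v {v. mfps_nth (g v) \<mu> \<noteq> 0}. (if w = v then 1 else 0) * mfps_nth (g w) \<mu>)"
    unfolding mfps_linear_delta[symmetric]
    by (rule mfps_subst_linear) (use g in \<open>auto simp: mfps_substitutable_def\<close>)
  also have "\<dots> = (\<Sum>w\<in>insert v {v. mfps_nth (g v) \<mu> \<noteq> 0}. if w = v then mfps_nth (g w) \<mu> else 0)"
    by (rule sum.cong) auto
  also have "\<dots> = mfps_nth (g v) \<mu>"
    using g by (subst sum.delta) (auto simp: mfps_substitutable_def)
  finally show "mfps_nth (mfps_subst g (mfps_var v)) \<mu> = mfps_nth (g v) \<mu>" .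
qed

text \<open>The product over a union of multisets is the product of the two products, which matches
  the convolution of coefficients. The work lies in finding finite index sets on which the sums can
  be rearranged.\<close>

lemma mfps_subst_mult: "mfps_subst g (F * G) = mfps_subst g F * mfps_subst g G"
proof (rule mfps_eqI)
  fix \<mu>
  define P where "P l = (\<Prod>v\<in>#l. g v)" for l
  define S where "S = (\<Union>\<alpha>\<in>{\<alpha>. \<alpha> \<subseteq># \<mu>}. subst_support g \<alpha>)"
  define S' where "S' = S \<union> (\<lambda>(x, y). x + y) ` (S \<times> S)"
  \<comment> \<open>Both parts of every splitting of a member of \<open>S'\<close> lie in
    \<open>D\<close>. The sum over splittings thus becomes a sum over a square, which is then cut
    down to \<open>S \<times> S\<close>.\<close>
  define D where "D = (\<Union>l\<in>S'. {\<alpha>. \<alpha> \<subseteq># l})"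
  have fin: "finite S" "finite S'" "finite D"
    by (auto simp: S_def S'_def D_def finite_submultisets finite_subst_support g)
  have P_add: "P (x + y) = P x * P y" for x y by (simp add: P_def)
  have SD: "S \<subseteq> D" unfolding D_def S'_def by auto
  have zero: "mfps_nth (P x) \<alpha> = 0" if "x \<notin> S" "\<alpha> \<subseteq># \<mu>" for x \<alpha>
    using that by (auto simp: S_def P_def subst_support_def)
  have zero2: "x + y \<in> S'" if "mfps_nth (P x * P y) \<mu> \<noteq> 0" for x y
    using that zero[of "x + y" \<mu>] by (auto simp: S'_def P_add)
  have "mfps_nth (mfps_subst g (F * G)) \<mu> = (\<Sum>l\<in>S'. mfps_nth (F * G) l * mfps_nth (P l) \<mu>)"
    unfolding P_def by (rule mfps_nth_subst) (use fin in \<open>auto simp: S_def S'_def\<close>)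
  also have "\<dots> = (\<Sum>l\<in>S'. \<Sum>x | x \<subseteq># l. mfps_nth F x * mfps_nth G (l - x) * mfps_nth (P l) \<mu>)"
    by (simp add: mfps_nth_mult sum_distrib_right)
  also have "\<dots> = (\<Sum>(l, x)\<in>(SIGMA l:S'. {x. x \<subseteq># l}). mfps_nth F x * mfps_nth G (l - x) * mfps_nth (P l) \<mu>)"
    by (simp add: sum.Sigma fin finite_submultisets)
  also have "\<dots> = (\<Sum>(x, y)\<in>{(x, y). x + y \<in> S'}. mfps_nth F x * mfps_nth G y * mfps_nth (P x * P y) \<mu>)"
    by (rule sum.reindex_bij_witness[of _ "\<lambda>(x, y). (x + y, x)" "\<lambda>(l, x). (x, l - x)"])
       (auto simp flip: P_add)
  also have "\<dots> = (\<Sum>(x, y)\<in>D \<times> D. mfps_nth F x * mfps_nth G y * mfps_nth (P x * P y) \<mu>)"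
    by (rule sum.mono_neutral_left) (use fin in \<open>auto simp: D_def intro: zero2\<close>)
  also have "\<dots> = (\<Sum>(x, y)\<in>S \<times> S. mfps_nth F x * mfps_nth G y * mfps_nth (P x * P y) \<mu>)"
  proof (rule sum.mono_neutral_right)
    have "x \<in> S \<and> y \<in> S" if "mfps_nth (P x * P y) \<mu> \<noteq> 0" for x y
      using that by (rule mfps_nth_mult_nonzeroE) (metis zero diff_subset_eq_self)
    then show "\<forall>z\<in>D \<times> D - S \<times> S. (case z of (x, y) \<Rightarrow> mfps_nth F x * mfps_nth G y * mfps_nth (P x * P y) \<mu>) = 0"
      by clarsimp (metis mult_zero_right)
  qed (use fin SD in auto)
  also have "\<dots> = (\<Sum>x\<in>S. \<Sum>y\<in>S. \<Sum>\<alpha> | \<alpha> \<subseteq># \<mu>.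
      (mfps_nth F x * mfps_nth (P x) \<alpha>) * (mfps_nth G y * mfps_nth (P y) (\<mu> - \<alpha>)))"
    by (simp add: mfps_nth_mult sum_distrib_left mult_ac flip: sum.cartesian_product)
  also have "\<dots> = (\<Sum>x\<in>S. \<Sum>\<alpha> | \<alpha> \<subseteq># \<mu>. \<Sum>y\<in>S.
      (mfps_nth F x * mfps_nth (P x) \<alpha>) * (mfps_nth G y * mfps_nth (P y) (\<mu> - \<alpha>)))"
    by (intro sum.cong refl sum.swap)
  also have "\<dots> = (\<Sum>\<alpha> | \<alpha> \<subseteq># \<mu>. \<Sum>x\<in>S. \<Sum>y\<in>S.
      (mfps_nth F x * mfps_nth (P x) \<alpha>) * (mfps_nth G y * mfps_nth (P y) (\<mu> - \<alpha>)))"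
    by (rule sum.swap)
  also have "\<dots> = (\<Sum>\<alpha> | \<alpha> \<subseteq># \<mu>. mfps_nth (mfps_subst g F) \<alpha> * mfps_nth (mfps_subst g G) (\<mu> - \<alpha>))"
  proof (rule sum.cong)
    fix \<alpha> assume \<alpha>: "\<alpha> \<in> {\<alpha>. \<alpha> \<subseteq># \<mu>}"
    have "mfps_nth (mfps_subst g H) \<beta> = (\<Sum>x\<in>S. mfps_nth H x * mfps_nth (P x) \<beta>)"
      if "\<beta> \<subseteq># \<mu>" for H \<beta>
      unfolding P_def by (rule mfps_nth_subst) (use fin that in \<open>auto simp: S_def\<close>)
    from this[of \<alpha> F] this[of "\<mu> - \<alpha>" G] \<alpha>
    show "(\<Sum>x\<in>S. \<Sum>y\<in>S. (mfps_nth F x * mfps_nth (P x) \<alpha>) * (mfps_nth G y * mfps_nth (P y) (\<mu> - \<alpha>))) =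
        mfps_nth (mfps_subst g F) \<alpha> * mfps_nth (mfps_subst g G) (\<mu> - \<alpha>)"
      by (simp add: sum_product)
  qed simp
  finally show "mfps_nth (mfps_subst g (F * G)) \<mu> = mfps_nth (mfps_subst g F * mfps_subst g G) \<mu>"
    by (simp add: mfps_nth_mult)
qed

lemma mfps_subst_power: "mfps_subst g (F ^ n) = mfps_subst g F ^ n"
  by (induction n) (simp_all add: mfps_subst_1 mfps_subst_mult)

lemma mfps_subst_prod_mset: "mfps_subst g (\<Prod>v\<in>#l. h v) = (\<Prod>v\<in>#l. mfps_subst g (h v))"
  by (induction l) (simp_all add: mfps_subst_1 mfps_subst_mult)

lemma mfps_subst_nth_empty: "mfps_nth (mfps_subst g F) {#} = mfps_nth F {#}"
proof -
  have "subst_support g {#} \<subseteq> {{#}}"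
    using size_le_if_subst_support[OF g, of _ "{#}"] by auto
  then show ?thesis by (subst mfps_nth_subst[of "{{#}}"]) (auto simp: mfps_nth_one)
qed

text \<open>Substitution by \<open>g\<close> is multiplicative, so it passes through the products
  over monomials; the rest is an interchange of two finite sums. The support of the composite is
  controlled by those of \<open>g\<close> and \<open>h\<close>.\<close>

lemma mfps_subst_subst:
  assumes h: "mfps_substitutable h"
  shows "mfps_subst g (mfps_subst h F) = mfps_subst (\<lambda>v. mfps_subst g (h v)) F"
proof (rule mfps_eqI)
  fix \<mu>
  define S where "S = subst_support g \<mu>"
  define S' where "S' = (\<Union>m\<in>S. subst_support h m)"
  have fin: "finite S" "finite S'"
    by (auto simp: S_def S'_def finite_subst_support g h)
  have *: "mfps_nth (\<Prod>v\<in>#l. mfps_subst g (h v)) \<mu> =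
      (\<Sum>m\<in>S. mfps_nth (\<Prod>v\<in>#l. h v) m * mfps_nth (\<Prod>v\<in>#m. g v) \<mu>)" for l
    unfolding mfps_subst_prod_mset[symmetric] S_def by (rule mfps_nth_subst_support[OF g])
  have "mfps_nth (mfps_subst g (mfps_subst h F)) \<mu> =
      (\<Sum>m\<in>S. mfps_nth (mfps_subst h F) m * mfps_nth (\<Prod>v\<in>#m. g v) \<mu>)"
    unfolding S_def by (rule mfps_nth_subst_support[OF g])
  also have "\<dots> = (\<Sum>m\<in>S. (\<Sum>l\<in>S'. mfps_nth F l * mfps_nth (\<Prod>v\<in>#l. h v) m) * mfps_nth (\<Prod>v\<in>#m. g v) \<mu>)"
    by (intro sum.cong arg_cong2[of _ _ _ _ "(*)"] mfps_nth_subst) (use fin in \<open>auto simp: S'_def\<close>)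
  also have "\<dots> = (\<Sum>l\<in>S'. mfps_nth F l * mfps_nth (\<Prod>v\<in>#l. mfps_subst g (h v)) \<mu>)"
    unfolding * sum_distrib_left sum_distrib_right by (subst sum.swap) (simp add: mult.assoc)
  also have "\<dots> = mfps_nth (mfps_subst (\<lambda>v. mfps_subst g (h v)) F) \<mu>"
  proof (rule mfps_nth_subst[symmetric])
    show "subst_support (\<lambda>v. mfps_subst g (h v)) \<mu> \<subseteq> S'"
    proof
      fix l assume "l \<in> subst_support (\<lambda>v. mfps_subst g (h v)) \<mu>"
      then have "(\<Sum>m\<in>S. mfps_nth (\<Prod>v\<in>#l. h v) m * mfps_nth (\<Prod>v\<in>#m. g v) \<mu>) \<noteq> 0"
        unfolding * [symmetric] by (simp add: subst_support_def)
      then obtain m where "m \<in> S" "mfps_nth (\<Prod>v\<in>#l. h v) m \<noteq> 0"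
        by (metis (no_types, lifting) mult_zero_left sum.neutral)
      then show "l \<in> S'" by (auto simp: S'_def subst_support_def)
    qed
  qed (rule fin)
  finally show "mfps_nth (mfps_subst g (mfps_subst h F)) \<mu> =
      mfps_nth (mfps_subst (\<lambda>v. mfps_subst g (h v)) F) \<mu>" .
qed

end

text \<open>Monomials contributing at \<mu> have size at most \<open>size \<mu>\<close>, so the
  truncation at \<open>size \<mu>\<close> is valid on both sides.\<close>

lemma mfps_subst_exp0:
  fixes g :: "'v \<Rightarrow> ('w, 'a::field_char_0) mfps"
  assumes g: "mfps_substitutable g" and F: "mfps_order_ge 1 F"
  shows "mfps_subst g (mfps_exp0 F) = mfps_exp0 (mfps_subst g F)"
proof (rule mfps_eqI)
  fix \<mu>
  have gF: "mfps_order_ge 1 (mfps_subst g F)"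
    using F unfolding mfps_order_ge_1_iff by (simp add: mfps_subst_nth_empty[OF g])
  have "mfps_nth (mfps_subst g (mfps_exp0 F)) \<mu> =
      (\<Sum>l\<in>subst_support g \<mu>. (\<Sum>n\<le>size \<mu>. mfps_nth (F ^ n) l / fact n) * mfps_nth (\<Prod>v\<in>#l. g v) \<mu>)"
    unfolding mfps_nth_subst_support[OF g]
    by (intro sum.cong arg_cong2[of _ _ _ _ "(*)"] mfps_nth_exp0 F)
       (auto dest: size_le_if_subst_support[OF g])
  also have "\<dots> = (\<Sum>n\<le>size \<mu>. (\<Sum>l\<in>subst_support g \<mu>. mfps_nth (F ^ n) l * mfps_nth (\<Prod>v\<in>#l. g v) \<mu>) / fact n)"
    unfolding sum_distrib_right sum_divide_distrib by (subst sum.swap) simp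
  also have "\<dots> = mfps_nth (mfps_exp0 (mfps_subst g F)) \<mu>"
    by (simp add: mfps_nth_exp0[OF gF order_refl] mfps_subst_power[OF g, symmetric]
        mfps_nth_subst_support[OF g])
  finally show "mfps_nth (mfps_subst g (mfps_exp0 F)) \<mu> = mfps_nth (mfps_exp0 (mfps_subst g F)) \<mu>" .
qed

lemma mfps_subst_exp:
  assumes "mfps_substitutable g"
  shows "mfps_subst g (mfps_exp F) = mfps_exp (mfps_subst g F)"
proof -
  have "mfps_order_ge 1 (F - mfps_const (mfps_nth F {#}))"
    unfolding mfps_order_ge_1_iff by (simp add: mfps_nth_const)
  then show ?thesis
    by (simp add: mfps_exp_def Let_def mfps_subst_mult mfps_subst_const mfps_subst_exp0
        mfps_subst_diff mfps_subst_nth_empty assms)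
qed

lemma mfps_subst_id: "mfps_subst mfps_var F = (F :: ('v, 'a::comm_ring_1) mfps)"
proof (rule mfps_eqI)
  fix \<mu>
  have *: "mfps_nth (\<Prod>v\<in>#l. mfps_var v) \<mu> = (if l = \<mu> then 1 else (0 :: 'a))" for l and \<mu> :: "'v multiset"
  proof (induction l arbitrary: \<mu>)
    case empty
    then show ?case by (auto simp: mfps_nth_one)
  next
    case (add v l)
    then show ?case by (auto simp: mfps_nth_var_mult)
  qed
  show "mfps_nth (mfps_subst mfps_var F) \<mu> = mfps_nth F \<mu>"
    by (subst mfps_nth_subst[of "{\<mu>}"]) (auto simp: subst_support_def *)
qed

section \<open>Change of coefficients and the local parameter\<close>

text \<open>Instantiated with the embedding of constants into Laurent series and with the
  substitution of X(w) for w in Laurent series.\<close>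

locale coeff_hom =
  fixes \<phi> :: "'a::comm_ring_1 \<Rightarrow> 'b::comm_ring_1"
  assumes hom_add: "\<phi> (x + y) = \<phi> x + \<phi> y"
    and hom_mult: "\<phi> (x * y) = \<phi> x * \<phi> y"
    and hom_1: "\<phi> 1 = 1"
begin

lemma hom_0: "\<phi> 0 = 0"
  using hom_add[of 0 0] by simp

lemma hom_minus: "\<phi> (- x) = - \<phi> x"
  using hom_add[of x "- x"] by (simp add: hom_0 eq_neg_iff_add_eq_0 add.commute)

lemma hom_sum: "\<phi> (sum f A) = (\<Sum>x\<in>A. \<phi> (f x))"
  by (induction A rule: infinite_finite_induct) (simp_all add: hom_0 hom_add)

lemma hom_power: "\<phi> (x ^ n) = \<phi> x ^ n"
  by (induction n) (simp_all add: hom_1 hom_mult)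

lemma hom_of_nat: "\<phi> (of_nat n) = of_nat n"
  by (induction n) (simp_all add: hom_0 hom_1 hom_add)

end

definition mfps_map :: "('a \<Rightarrow> 'b) \<Rightarrow> ('v, 'a) mfps \<Rightarrow> ('v, 'b) mfps" where
  "mfps_map \<phi> F = Abs_mfps (\<lambda>\<mu>. \<phi> (mfps_nth F \<mu>))"

lemma mfps_nth_map [simp]: "mfps_nth (mfps_map \<phi> F) \<mu> = \<phi> (mfps_nth F \<mu>)"
  by (simp add: mfps_map_def)

context coeff_hom
begin

lemma mfps_map_1: "mfps_map \<phi> 1 = 1"
  by (rule mfps_eqI) (simp add: mfps_nth_one hom_0 hom_1)

lemma mfps_map_mult: "mfps_map \<phi> (F * G) = mfps_map \<phi> F * mfps_map \<phi> G"
  by (rule mfps_eqI) (simp add: mfps_nth_mult hom_sum hom_mult)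

lemma mfps_map_power: "mfps_map \<phi> (F ^ n) = mfps_map \<phi> F ^ n"
  by (induction n) (simp_all add: mfps_map_1 mfps_map_mult)

lemma mfps_map_prod_mset: "mfps_map \<phi> (\<Prod>v\<in>#l. g v) = (\<Prod>v\<in>#l. mfps_map \<phi> (g v))"
  by (induction l) (simp_all add: mfps_map_1 mfps_map_mult)

lemma mfps_map_linear: "mfps_map \<phi> (mfps_linear f) = mfps_linear (\<lambda>v. \<phi> (f v))"
  by (rule mfps_linear_eqI) (simp_all add: mfps_nth_linear_size hom_0)

lemma mfps_substitutable_map:
  assumes "mfps_substitutable g"
  shows "mfps_substitutable (\<lambda>v. mfps_map \<phi> (g v))"
  unfolding mfps_substitutable_def
proof (intro conjI allI)
  show "finite {v. mfps_nth (mfps_map \<phi> (g v)) \<mu> \<noteq> 0}" for \<mu>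
    by (rule finite_subset[of _ "{v. mfps_nth (g v) \<mu> \<noteq> 0}"])
       (use assms in \<open>auto simp: hom_0 mfps_substitutable_def\<close>)
qed (use assms in \<open>auto simp: hom_0 mfps_substitutable_def\<close>)

end

lemma mfps_map_exp0:
  fixes \<phi> :: "'a::field_char_0 \<Rightarrow> 'b::field_char_0"
  assumes "coeff_hom \<phi>"
  shows "mfps_map \<phi> (mfps_exp0 F) = mfps_exp0 (mfps_map \<phi> F)"
proof (rule mfps_eqI)
  interpret coeff_hom \<phi> by fact
  \<comment> \<open>A unital ring homomorphism fixes natural numbers, hence commutes with division
    by n!.\<close>
  have *: "\<phi> (x / fact n) = \<phi> x / fact n" for x n
  proof -
    have "\<phi> (x / fact n) * fact n = \<phi> (x / fact n) * \<phi> (of_nat (fact n))"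
      using hom_of_nat[of "fact n"] by simp
    also have "\<dots> = \<phi> x"
      by (simp flip: hom_mult)
    finally show ?thesis by (simp add: field_simps)
  qed
  fix \<mu>
  show "mfps_nth (mfps_map \<phi> (mfps_exp0 F)) \<mu> = mfps_nth (mfps_exp0 (mfps_map \<phi> F)) \<mu>"
    by (simp add: mfps_exp0_def hom_sum * flip: mfps_map_power)
qed

interpretation fls_const: coeff_hom "fls_const :: complex \<Rightarrow> complex fls"
  by unfold_locales (simp_all add: fls_plus_const fls_const_mult_const)

lemma coeff_hom_fls_compose_fps:
  assumes "X \<noteq> 0" "fps_nth X 0 = 0"
  shows "coeff_hom (\<lambda>f :: complex fls. fls_compose_fps f X)"
  using assms by unfold_locales (simp_all add: fls_compose_fps_add fls_compose_fps_mult)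

section \<open>Separating the local parameter w from the times\<close>

definition some_part :: "'v option multiset \<Rightarrow> 'v multiset" where
  "some_part \<nu> = image_mset the {#x \<in># \<nu>. x \<noteq> None#}"

lemma some_part_union [simp]: "some_part (\<mu> + \<nu>) = some_part \<mu> + some_part \<nu>"
  by (simp add: some_part_def)

lemma some_part_image_Some [simp]: "some_part (image_mset Some \<mu>) = \<mu>"
  by (induction \<mu>) (auto simp: some_part_def)

lemma some_part_replicate_None [simp]: "some_part (replicate_mset n None) = {#}"
  by (induction n) (auto simp: some_part_def)

lemma some_none_decomp: "image_mset Some (some_part \<nu>) + replicate_mset (count \<nu> None) None = \<nu>"
  by (induction \<nu>) (auto simp: some_part_def)

lemma count_None_collect [simp]: "count (image_mset Some \<mu> + replicate_mset n None) None = n"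
proof -
  have "count (image_mset Some \<mu>) None = 0" by (simp add: count_eq_zero_iff)
  then show ?thesis by simp
qed

lemma some_none_cases:
  obtains \<mu> n where "\<nu> = image_mset Some \<mu> + replicate_mset n None"
  using some_none_decomp by metis

lemma inj_some_none: "inj (\<lambda>(\<mu>, n). image_mset Some \<mu> + replicate_mset n None)"
  by (rule inj_on_inverseI[of _ "\<lambda>\<nu>. (some_part \<nu>, count \<nu> None)"])
     (auto simp del: count_union)

text \<open>A divisor of \<mu> w^n is a divisor of \<mu> times some w^i with i at most n. This
  splits the product of series into a convolution over \<mu> and an ordinary product of power series
  in w.\<close>

lemma submultisets_some_none:
  "{\<nu>. \<nu> \<subseteq># image_mset Some \<mu> + replicate_mset n None} =
    (\<lambda>(\<alpha>, i). image_mset Some \<alpha> + replicate_mset i None) ` ({\<alpha>. \<alpha> \<subseteq># \<mu>} \<times> {..n})"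
proof (intro equalityI subsetI)
  fix \<nu> assume \<nu>: "\<nu> \<in> {\<nu>. \<nu> \<subseteq># image_mset Some \<mu> + replicate_mset n None}"
  then have "some_part \<nu> \<subseteq># some_part (image_mset Some \<mu> + replicate_mset n None)"
    unfolding some_part_def by (intro image_mset_subseteq_mono multiset_filter_mono) simp
  moreover have "count \<nu> None \<le> count (image_mset Some \<mu> + replicate_mset n None) None"
    using \<nu> by (simp only: mem_Collect_eq mset_subset_eq_count)
  ultimately have "(some_part \<nu>, count \<nu> None) \<in> {\<alpha>. \<alpha> \<subseteq># \<mu>} \<times> {..n}"
    by (simp del: count_union)
  then show "\<nu> \<in> (\<lambda>(\<alpha>, i). image_mset Some \<alpha> + replicate_mset i None) ` ({\<alpha>. \<alpha> \<subseteq># \<mu>} \<times> {..n})"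
    by (rule rev_image_eqI) (simp add: some_none_decomp)
next
  fix \<nu> assume "\<nu> \<in> (\<lambda>(\<alpha>, i). image_mset Some \<alpha> + replicate_mset i None) ` ({\<alpha>. \<alpha> \<subseteq># \<mu>} \<times> {..n})"
  then show "\<nu> \<in> {\<nu>. \<nu> \<subseteq># image_mset Some \<mu> + replicate_mset n None}"
    by (auto intro!: subset_mset.add_mono image_mset_subseteq_mono simp: subseteq_mset_def[of "replicate_mset _ _"])
qed

text \<open>The coefficients of \<open>collect_w\<close> before their embedding into Laurent series,
  where they can be compared degree by degree and composed by \<open>oo\<close>.\<close>

definition w_coeff :: "('v option, complex) mfps \<Rightarrow> 'v multiset \<Rightarrow> complex fps" where
  "w_coeff F \<mu> = Abs_fps (\<lambda>n. mfps_nth F (image_mset Some \<mu> + replicate_mset n None))"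

lemma mfps_nth_collect_w: "mfps_nth (collect_w F) \<mu> = fps_to_fls (w_coeff F \<mu>)"
  by (simp add: collect_w_def w_coeff_def)

lemma w_coeff_eqI: "(\<And>\<mu> n. fps_nth (w_coeff F \<mu>) n = fps_nth (w_coeff G \<mu>) n) \<Longrightarrow> F = G"
  by (rule mfps_eqI) (metis fps_nth_Abs_fps some_none_cases w_coeff_def)

lemma w_coeff_1: "w_coeff 1 \<mu> = (if \<mu> = {#} then 1 else 0)"
  by (rule fps_ext) (auto simp: w_coeff_def mfps_nth_one)

lemma w_coeff_mult: "w_coeff (F * G) \<mu> = (\<Sum>\<alpha> | \<alpha> \<subseteq># \<mu>. w_coeff F \<alpha> * w_coeff G (\<mu> - \<alpha>))"
proof (rule fps_ext)
  fix n
  let ?j = "\<lambda>(\<alpha>, i). image_mset Some \<alpha> + replicate_mset i None"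
  have diff: "?j (\<mu>, n) - ?j (\<alpha>, i) = ?j (\<mu> - \<alpha>, n - i)" if "\<alpha> \<subseteq># \<mu>" "i \<le> n" for \<alpha> i
  proof -
    have "?j (\<mu>, n) = ?j (\<mu> - \<alpha>, n - i) + ?j (\<alpha>, i)"
    proof -
      have "\<mu> = (\<mu> - \<alpha>) + \<alpha>" using that by simp
      moreover have "replicate_mset n None = replicate_mset (n - i) None + replicate_mset i (None :: 'a option)"
        using that by (intro multiset_eqI) auto
      ultimately show ?thesis by (metis (no_types, lifting) case_prod_conv image_mset_union union_assoc union_commute union_lcomm)
    qed
    then show ?thesis by (simp only: add_diff_cancel_right')
  qed
  have "fps_nth (w_coeff (F * G) \<mu>) n =
      (\<Sum>\<nu>\<in>?j ` ({\<alpha>. \<alpha> \<subseteq># \<mu>} \<times> {..n}). mfps_nth F \<nu> * mfps_nth G (?j (\<mu>, n) - \<nu>))"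
    unfolding submultisets_some_none[symmetric] by (simp add: w_coeff_def mfps_nth_mult)
  also have "\<dots> = (\<Sum>x\<in>{\<alpha>. \<alpha> \<subseteq># \<mu>} \<times> {..n}. mfps_nth F (?j x) * mfps_nth G (?j (\<mu>, n) - ?j x))"
    by (subst sum.reindex) (use inj_some_none inj_on_subset in \<open>auto simp: o_def\<close>)
  also have "\<dots> = (\<Sum>(\<alpha>, i)\<in>{\<alpha>. \<alpha> \<subseteq># \<mu>} \<times> {..n}. mfps_nth F (?j (\<alpha>, i)) * mfps_nth G (?j (\<mu> - \<alpha>, n - i)))"
    by (rule sum.cong) (auto simp: diff[unfolded prod.case])
  also have "\<dots> = (\<Sum>\<alpha> | \<alpha> \<subseteq># \<mu>. \<Sum>i\<le>n. mfps_nth F (?j (\<alpha>, i)) * mfps_nth G (?j (\<mu> - \<alpha>, n - i)))"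
    by (rule sum.cartesian_product[symmetric])
  also have "\<dots> = fps_nth (\<Sum>\<alpha> | \<alpha> \<subseteq># \<mu>. w_coeff F \<alpha> * w_coeff G (\<mu> - \<alpha>)) n"
    by (simp add: fps_sum_nth fps_mult_nth w_coeff_def atLeast0AtMost)
  finally show "fps_nth (w_coeff (F * G) \<mu>) n =
      fps_nth (\<Sum>\<alpha> | \<alpha> \<subseteq># \<mu>. w_coeff F \<alpha> * w_coeff G (\<mu> - \<alpha>)) n" .
qed

lemma fps_to_fls_sum: "fps_to_fls (sum f A) = (\<Sum>x\<in>A. fps_to_fls (f x :: complex fps))"
  by (induction A rule: infinite_finite_induct) auto

lemma collect_w_mult: "collect_w (F * G) = collect_w F * collect_w G"
  by (rule mfps_eqI)
     (simp add: mfps_nth_mult mfps_nth_collect_w w_coeff_mult fps_to_fls_sum fls_times_fps_to_fls)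

lemma collect_w_1: "collect_w 1 = 1"
  by (rule mfps_eqI) (simp add: mfps_nth_collect_w w_coeff_1 mfps_nth_one)

lemma collect_w_prod_mset: "collect_w (\<Prod>v\<in>#l. g v) = (\<Prod>v\<in>#l. collect_w (g v))"
  by (induction l) (simp_all add: collect_w_1 collect_w_mult)

lemma collect_w_power: "collect_w (F ^ n) = collect_w F ^ n"
  by (induction n) (simp_all add: collect_w_1 collect_w_mult)

text \<open>Changes the times by \<open>T\<close> and the local parameter by X in a single
  \<open>mfps_subst\<close>, so that \<open>mfps_subst_subst\<close> can be applied to the combined
  change.\<close>

definition w_subst ::
    "('v \<Rightarrow> ('u, complex) mfps) \<Rightarrow> complex fps \<Rightarrow> 'v option \<Rightarrow> ('u option, complex) mfps" where
  "w_subst T X o' = (case o' of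
      Some v \<Rightarrow> Abs_mfps (\<lambda>\<nu>. if None \<in># \<nu> then 0 else mfps_nth (T v) (some_part \<nu>))
    | None \<Rightarrow> Abs_mfps (\<lambda>\<nu>. if some_part \<nu> = {#} then fps_nth X (count \<nu> None) else 0))"

lemma w_coeff_w_subst_Some: "w_coeff (w_subst T X (Some v)) \<mu> = fps_const (mfps_nth (T v) \<mu>)"
  by (rule fps_ext) (auto simp: w_coeff_def w_subst_def)

lemma collect_w_w_subst_Some: "collect_w (w_subst T X (Some v)) = mfps_map fls_const (T v)"
  by (rule mfps_eqI) (simp add: mfps_nth_collect_w w_coeff_w_subst_Some)

lemma w_coeff_w_subst_None: "w_coeff (w_subst T X None) \<mu> = (if \<mu> = {#} then X else 0)"
  by (rule fps_ext) (auto simp: w_coeff_def w_subst_def simp del: count_union)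

lemma collect_w_w_subst_None: "collect_w (w_subst T X None) = mfps_const (fps_to_fls X)"
  by (rule mfps_eqI) (simp add: mfps_nth_collect_w w_coeff_w_subst_None mfps_nth_const)

lemma w_coeff_w_subst_None_power:
  "w_coeff (w_subst T X None ^ k) \<mu> = (if \<mu> = {#} then X ^ k else 0)"
proof -
  have "fps_to_fls (w_coeff (w_subst T X None ^ k) \<mu>) = fps_to_fls (if \<mu> = {#} then X ^ k else 0)"
    by (simp flip: mfps_nth_collect_w
        add: collect_w_power collect_w_w_subst_None mfps_const_power[symmetric] mfps_nth_const fps_to_fls_power)
  then show ?thesis by (simp only: fps_to_fls_eq_iff)
qed

lemma mfps_substitutable_w_subst:
  assumes T: "mfps_substitutable T" and X: "fps_nth X 0 = 0"
  shows "mfps_substitutable (w_subst T X)"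
  unfolding mfps_substitutable_def
proof (intro conjI allI)
  fix \<nu>
  show "mfps_nth (w_subst T X v) {#} = 0" for v
    using assms by (auto simp: w_subst_def some_part_def mfps_substitutable_def split: option.splits)
  have "{v. mfps_nth (w_subst T X v) \<nu> \<noteq> 0} \<subseteq> insert None (Some ` {v. mfps_nth (T v) (some_part \<nu>) \<noteq> 0})"
  proof
    fix v assume "v \<in> {v. mfps_nth (w_subst T X v) \<nu> \<noteq> 0}"
    then show "v \<in> insert None (Some ` {v. mfps_nth (T v) (some_part \<nu>) \<noteq> 0})"
      by (cases v) (auto simp: w_subst_def split: if_splits)
  qed
  moreover have "finite \<dots>" using T by (simp add: mfps_substitutable_def)
  ultimately show "finite {v. mfps_nth (w_subst T X v) \<nu> \<noteq> 0}" by (rule finite_subset)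
qed

text \<open>Computed after \<open>collect_w\<close>, which is multiplicative; the embedding
  \<open>fps_to_fls\<close> is injective, so the result can be read back.\<close>

lemma w_coeff_prod_w_subst:
  "w_coeff (\<Prod>v\<in>#image_mset Some l + replicate_mset k None. w_subst T X v) \<mu> =
    fps_const (mfps_nth (\<Prod>v\<in>#l. T v) \<mu>) * X ^ k"
proof -
  have "collect_w (\<Prod>v\<in>#image_mset Some l + replicate_mset k None. w_subst T X v) =
      mfps_const (fps_to_fls X ^ k) * mfps_map fls_const (\<Prod>v\<in>#l. T v)"
    by (simp add: collect_w_mult collect_w_prod_mset collect_w_power collect_w_w_subst_Some
        collect_w_w_subst_None fls_const.mfps_map_prod_mset mfps_const_power image_mset.compositionality
        o_def mult.commute)
  then have "fps_to_fls (w_coeff (\<Prod>v\<in>#image_mset Some l + replicate_mset k None. w_subst T X v) \<mu>) =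
      fps_to_fls (fps_const (mfps_nth (\<Prod>v\<in>#l. T v) \<mu>) * X ^ k)"
    by (simp flip: mfps_nth_collect_w add: fls_times_fps_to_fls fps_to_fls_power mult.commute)
  then show ?thesis by (simp only: fps_to_fls_eq_iff)
qed

text \<open>Once w is moved into the coefficients, the combined change splits into composition with
  X on coefficients and substitution of \<open>T\<close> on monomials. At w^n only the powers X^k
  with k at most n contribute, and the sum over k is the one defining composition.\<close>

lemma collect_w_subst:
  fixes T :: "'v \<Rightarrow> ('u, complex) mfps"
  assumes T: "mfps_substitutable T" and X: "fps_nth X 0 = 0" "X \<noteq> 0"
  shows "collect_w (mfps_subst (w_subst T X) F) =
    mfps_subst (\<lambda>v. mfps_map fls_const (T v)) (mfps_map (\<lambda>f. fls_compose_fps f X) (collect_w F))"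
proof (rule mfps_eqI)
  fix \<mu>
  let ?j = "\<lambda>(\<alpha>, i). image_mset Some \<alpha> + replicate_mset i (None :: 'v option)"
  define S where "S = subst_support T \<mu>"
  define c where "c l = mfps_nth (\<Prod>v\<in>#l. T v) \<mu>" for l
  have fin: "finite S" by (simp add: S_def finite_subst_support T)
  have "w_coeff (mfps_subst (w_subst T X) F) \<mu> = (\<Sum>l\<in>S. (w_coeff F l oo X) * fps_const (c l))"
  proof (rule fps_ext)
    fix n
    have coeff: "mfps_nth (\<Prod>v\<in>#?j x. w_subst T X v) (image_mset Some \<mu> + replicate_mset n None) =
        c (fst x) * fps_nth (X ^ snd x) n" for x
      using arg_cong[OF w_coeff_prod_w_subst[of T X "fst x" "snd x" \<mu>], of "\<lambda>f. fps_nth f n"]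
      by (simp add: w_coeff_def c_def case_prod_unfold)
    have X0: "fps_nth (X ^ k) n = 0" if "n < k" for k
      using X that by (simp add: startsby_zero_power_prefix)
    have "subst_support (w_subst T X) (image_mset Some \<mu> + replicate_mset n None) \<subseteq> ?j ` (S \<times> {..n})"
    proof
      fix L assume L: "L \<in> subst_support (w_subst T X) (image_mset Some \<mu> + replicate_mset n None)"
      obtain l k where lk: "L = ?j (l, k)" using some_none_cases[of L] by auto
      with L coeff[of "(l, k)"] have "c l * fps_nth (X ^ k) n \<noteq> 0"
        by (simp add: subst_support_def)
      then have "c l \<noteq> 0" "fps_nth (X ^ k) n \<noteq> 0" by auto
      then have "(l, k) \<in> S \<times> {..n}" using X0[of k] by (auto simp: S_def subst_support_def c_def not_less[symmetric])
      with lk show "L \<in> ?j ` (S \<times> {..n})" by (rule image_eqI)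
    qed
    then have "fps_nth (w_coeff (mfps_subst (w_subst T X) F) \<mu>) n =
        (\<Sum>L\<in>?j ` (S \<times> {..n}). mfps_nth F L *
          mfps_nth (\<Prod>v\<in>#L. w_subst T X v) (image_mset Some \<mu> + replicate_mset n None))"
      unfolding w_coeff_def fps_nth_Abs_fps by (intro mfps_nth_subst) (auto simp: fin)
    also have "\<dots> = (\<Sum>x\<in>S \<times> {..n}. mfps_nth F (?j x) * (c (fst x) * fps_nth (X ^ snd x) n))"
      unfolding coeff[symmetric]
      by (subst sum.reindex) (use inj_some_none inj_on_subset in \<open>auto simp: o_def\<close>)
    also have "\<dots> = (\<Sum>l\<in>S. \<Sum>k\<le>n. mfps_nth F (?j (l, k)) * (c l * fps_nth (X ^ k) n))"
      by (simp add: sum.cartesian_product case_prod_unfold)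
    also have "\<dots> = fps_nth (\<Sum>l\<in>S. (w_coeff F l oo X) * fps_const (c l)) n"
      by (simp add: fps_sum_nth fps_compose_nth w_coeff_def atLeast0AtMost sum_distrib_left sum_distrib_right mult_ac)
    finally show "fps_nth (w_coeff (mfps_subst (w_subst T X) F) \<mu>) n =
        fps_nth (\<Sum>l\<in>S. (w_coeff F l oo X) * fps_const (c l)) n" .
  qed
  then have "mfps_nth (collect_w (mfps_subst (w_subst T X) F)) \<mu> =
      (\<Sum>l\<in>S. fls_compose_fps (mfps_nth (collect_w F) l) X * fls_const (c l))"
    using X by (simp add: mfps_nth_collect_w fps_to_fls_sum fls_times_fps_to_fls)
  also have "\<dots> = mfps_nth (mfps_subst (\<lambda>v. mfps_map fls_const (T v))
      (mfps_map (\<lambda>f. fls_compose_fps f X) (collect_w F))) \<mu>"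
    by (subst mfps_nth_subst[OF fin])
       (auto simp: S_def subst_support_def c_def simp flip: fls_const.mfps_map_prod_mset)
  finally show "mfps_nth (collect_w (mfps_subst (w_subst T X) F)) \<mu> =
      mfps_nth (mfps_subst (\<lambda>v. mfps_map fls_const (T v))
        (mfps_map (\<lambda>f. fls_compose_fps f X) (collect_w F))) \<mu>" .
qed

section \<open>Linear substitutions and fractional linear changes of the local parameter\<close>

lemma mfps_substitutable_linear:
  assumes "\<And>w. finite {v. m v w \<noteq> 0}"
  shows "mfps_substitutable (\<lambda>v. mfps_linear (m v))"
  unfolding mfps_substitutable_def
proof (intro conjI allI)
  show "finite {v. mfps_nth (mfps_linear (m v)) \<mu> \<noteq> 0}" for \<mu>
  proof (cases "size \<mu> = 1")
    case True
    then obtain w where "\<mu> = {#w#}" using size_1_singleton_mset by blast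
    then show ?thesis using assms by simp
  qed (simp add: mfps_nth_linear_size)
qed (simp add: mfps_nth_linear_size)

text \<open>Multiplication of a row vector by a matrix with finite columns; \<open>A w\<close> is
  any finite set covering column w.\<close>

lemma mfps_subst_linear_linear:
  assumes m: "mfps_substitutable (\<lambda>v. mfps_linear (m v))"
    and A: "\<And>w. finite (A w)" "\<And>w. {v. m v w \<noteq> 0} \<subseteq> A w"
  shows "mfps_subst (\<lambda>v. mfps_linear (m v)) (mfps_linear f) = mfps_linear (\<lambda>w. \<Sum>v\<in>A w. f v * m v w)"
proof (rule mfps_linear_eqI)
  fix \<mu> :: "'b multiset" assume "size \<mu> \<noteq> 1"
  then show "mfps_nth (mfps_subst (\<lambda>v. mfps_linear (m v)) (mfps_linear f)) \<mu> = 0"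
    using mfps_subst_linear[OF m, of "{}" \<mu> f] by (simp add: mfps_nth_linear_size)
next
  fix w
  show "mfps_nth (mfps_subst (\<lambda>v. mfps_linear (m v)) (mfps_linear f)) {#w#} = (\<Sum>v\<in>A w. f v * m v w)"
    using mfps_subst_linear[OF m, of "A w" "{#w#}" f] A by simp
qed

section \<open>Geometric series and the logarithmic derivative\<close>

lemma fps_geometric:
  fixes c :: "'k::comm_ring_1"
  shows "Abs_fps (\<lambda>n. d * c ^ n) * (1 - fps_const c * fps_X) = fps_const d"
proof (rule fps_ext)
  fix n
  have "Abs_fps (\<lambda>n. d * c ^ n) * (1 - fps_const c * fps_X) =
      Abs_fps (\<lambda>n. d * c ^ n) - fps_const c * (Abs_fps (\<lambda>n. d * c ^ n) * fps_X)"
    by (simp add: algebra_simps)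
  then show "fps_nth (Abs_fps (\<lambda>n. d * c ^ n) * (1 - fps_const c * fps_X)) n = fps_nth (fps_const d) n"
    by (cases n) simp_all
qed

text \<open>
  Both sides are the derivative of
  \<open>- ln (1 - y X(s)) = - ln (1 - z s) + ln (1 + \<beta> s)\<close>.
\<close>

lemma deriv_log_compose:
  fixes X :: "'k::field_char_0 fps"
  assumes X: "X * (1 + fps_const \<beta> * fps_X) = fps_const \<alpha> * fps_X"
    and X0: "fps_nth X 0 = 0" and y: "\<alpha> * y = z + \<beta>"
  shows "fps_deriv (Abs_fps (\<lambda>k. y ^ k / of_nat k) oo X) =
    Abs_fps (\<lambda>j. z ^ Suc j + \<beta> * (- \<beta>) ^ j)"
proof -
  define u where "u = 1 + fps_const \<beta> * fps_X"
  define v where "v = 1 - fps_const z * fps_X"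
  define F where "F = Abs_fps (\<lambda>k. y * y ^ k)"
  define G where "G = (F oo X)"
  define V where "V = Abs_fps (\<lambda>j. z ^ Suc j + \<beta> * (- \<beta>) ^ j)"
  \<comment> \<open>The coefficient at k = 0 is 1 / 0 = 0, so the series is - ln (1 - y s), with
    derivative y / (1 - y s).\<close>
  have 1: "fps_deriv (Abs_fps (\<lambda>k. y ^ k / of_nat k)) = F"
    by (rule fps_ext) (simp add: F_def del: of_nat_Suc)
  have W: "fps_deriv (Abs_fps (\<lambda>k. y ^ k / of_nat k) oo X) = G * fps_deriv X"
    by (simp add: fps_compose_deriv X0 1 G_def)
  have "(F * (1 - fps_const y * fps_X)) oo X = fps_const y"
    unfolding F_def fps_geometric by simp
  then have G: "G * (1 - fps_const y * X) = fps_const y"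
    by (simp add: G_def fps_compose_mult_distrib X0 fps_compose_sub_distrib)
  have c: "fps_const \<alpha> * fps_const y = fps_const z + fps_const \<beta>"
    by (simp add: y)
  have Xu: "X * u = fps_const \<alpha> * fps_X" using X by (simp add: u_def)
  have "fps_deriv (X * u) = fps_const \<alpha>" unfolding Xu by simp
  then have X': "fps_deriv X * u + X * fps_const \<beta> = fps_const \<alpha>"
    by (simp add: u_def algebra_simps)
  \<comment> \<open>Follows from G (1 - y X) = y and (1 - y X) u = v; the latter is where \<alpha> y
    = z + \<beta> enters.\<close>
  have Gv: "G * v = fps_const y * u"
  proof -
    have "fps_const y * u = (G * (1 - fps_const y * X)) * u"
      by (simp only: G)
    also have "\<dots> = G * (u - fps_const y * (X * u))"
      by (simp add: algebra_simps)
    also have "u - fps_const y * (X * u) = v"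
    proof -
      have "fps_const y * (X * u) = (fps_const \<alpha> * fps_const y) * fps_X"
        unfolding Xu by (simp only: mult_ac)
      also have "\<dots> = fps_const z * fps_X + fps_const \<beta> * fps_X"
        unfolding c by (simp only: distrib_right)
      finally show ?thesis by (simp add: u_def v_def)
    qed
    finally show ?thesis ..
  qed
  \<comment> \<open>The quotient rule X' = \<alpha> / u^2 in denominator-free form.\<close>
  have X'uu: "fps_deriv X * u * u = fps_const \<alpha>"
  proof -
    have "fps_deriv X * u * u + X * u * fps_const \<beta> = fps_const \<alpha> * u"
      unfolding X'[symmetric] by (simp only: distrib_right mult_ac) (simp only: distrib_left mult_ac)
    moreover have "fps_const \<alpha> * u = fps_const \<alpha> + fps_const \<alpha> * fps_X * fps_const \<beta>"
      by (simp add: u_def algebra_simps)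
    ultimately show ?thesis by (simp only: Xu add_right_cancel)
  qed
  have "G * fps_deriv X * (v * u) = (G * v) * (fps_deriv X * u)"
    by (simp only: mult_ac)
  also have "\<dots> = fps_const y * (fps_deriv X * u * u)"
    unfolding Gv by (simp only: mult_ac)
  also have "\<dots> = fps_const z + fps_const \<beta>"
    unfolding X'uu c[symmetric] by (rule mult.commute)
  finally have "G * fps_deriv X * (v * u) = fps_const z + fps_const \<beta>" .
  \<comment> \<open>Partial fractions: V is the sum of z / v and \<beta> / u, with common numerator
    z u + \<beta> v = z + \<beta>.\<close>
  moreover have "V * (v * u) = fps_const z + fps_const \<beta>"
  proof -
    define P where "P = Abs_fps (\<lambda>j. z * z ^ j)"
    define Q where "Q = Abs_fps (\<lambda>j. \<beta> * (- \<beta>) ^ j)"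
    have Pv: "P * v = fps_const z"
      unfolding P_def v_def by (rule fps_geometric)
    have Qu: "Q * u = fps_const \<beta>"
      using fps_geometric[of \<beta> "- \<beta>"] by (simp add: u_def Q_def flip: fps_const_neg)
    have "V = P + Q"
      by (rule fps_ext) (simp add: V_def P_def Q_def)
    then have "V * (v * u) = (P * v) * u + (Q * u) * v"
      by (simp add: algebra_simps)
    also have "\<dots> = fps_const z * u + fps_const \<beta> * v"
      unfolding Pv Qu ..
    also have "\<dots> = fps_const z + fps_const \<beta>"
      by (simp add: u_def v_def algebra_simps)
    finally show ?thesis .
  qed
  moreover have "v * u \<noteq> 0"
  proof -
    have "fps_nth (v * u) 0 = 1" by (simp add: u_def v_def)
    then show ?thesis by (metis fps_zero_nth zero_neq_one)
  qed
  ultimately have "G * fps_deriv X = V" by (metis mult_right_cancel)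
  then show ?thesis by (simp add: W V_def)
qed

section \<open>Residues at infinity and the fractional linear change of w\<close>

lemma fls_X_times_X_inv: "fls_X * fls_X_inv = (1 :: complex fls)"
  by (simp add: fls_X_inv_times_conv_shift fls_X_conv_shift_1)

text \<open>Since dz = - w^(-2) dw, the coefficient of w^(-1) in the product is minus the
  coefficient of w in \<open>f\<close>.\<close>

lemma residue_infinity_eq: "residue_infinity f = - fls_nth f 1"
proof -
  have "fls_deriv (fls_X_inv :: complex fls) = - fls_shift 2 1"
    by (simp add: fls_X_inv_power_conv_shift_1)
  moreover have "fls_nth (f * fls_shift 2 1) (-1) = fls_nth f 1"
    using fls_X_intpow_times_conv_shift(2)[of f "-2"] by simp
  ultimately show ?thesis by (simp add: residue_infinity_def fls_residue_def)
qed

text \<open>The equation of X with its denominator cleared, a form that can be multiplied out,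
  composed, and carried over to Laurent coefficients.\<close>

locale mobius_change =
  fixes a b :: complex and X :: "complex fps"
  assumes a: "a \<noteq> 0" and X_eq: "X * (1 + fps_const b * fps_X) = fps_const a * fps_X"
begin

lemma mobius_nth_0: "fps_nth X 0 = 0"
  using arg_cong[OF X_eq, of "\<lambda>f. fps_nth f 0"] by simp

lemma mobius_nth_1: "fps_nth X 1 = a"
proof -
  have "X * (1 + fps_const b * fps_X) = X + fps_const b * (X * fps_X)"
    by (simp add: algebra_simps)
  then show ?thesis
    using arg_cong[OF X_eq, of "\<lambda>f. fps_nth f 1"] mobius_nth_0 by simp
qed

lemma mobius_nonzero: "X \<noteq> 0"
  using mobius_nth_1 a by auto

sublocale compose: coeff_hom "\<lambda>f. fls_compose_fps f X"
  by (rule coeff_hom_fls_compose_fps[OF mobius_nonzero mobius_nth_0])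

text \<open>In terms of \<open>z = 1/w\<close>, the substitution is the affine map \<open>z \<mapsto> (z + b) / a\<close>.\<close>

lemma compose_X_inv: "fls_const a * fls_compose_fps fls_X_inv X = fls_X_inv + fls_const b"
proof -
  define x where "x = fps_to_fls X"
  define y where "y = fls_compose_fps fls_X_inv X"
  note w = fls_X_times_X_inv
  have xy: "x * y = 1"
    using compose.hom_mult[of fls_X fls_X_inv] by (simp add: x_def y_def w compose.hom_1)
  have "fps_to_fls (X * (1 + fps_const b * fps_X)) = fps_to_fls (fps_const a * fps_X)"
    by (simp only: X_eq)
  then have eq: "x * (1 + fls_const b * fls_X) = fls_const a * fls_X"
    by (simp add: fls_times_fps_to_fls x_def)
  have "fls_const a * y = (fls_const a * fls_X) * y * fls_X_inv"
    using w by (simp add: mult_ac)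
  also have "\<dots> = x * y * (1 + fls_const b * fls_X) * fls_X_inv"
    unfolding eq[symmetric] by (simp only: mult_ac)
  also have "\<dots> = fls_X_inv + fls_const b * (fls_X * fls_X_inv)"
    by (simp add: xy distrib_right mult.assoc)
  finally have "fls_const a * y = fls_X_inv + fls_const b"
    by (simp only: w mult_1_right)
  then show ?thesis by (simp add: y_def)
qed

text \<open>The power z^n becomes ((z + b) / a)^n, a polynomial in z, hence without positive powers
  of w.\<close>

lemma compose_X_inv_power_nth:
  assumes "k > 0"
  shows "fls_nth (fls_compose_fps (fls_X_inv ^ n) X) k = 0"
  using assms
proof (induction n arbitrary: k)
  case (Suc n)
  have "fls_const a * fls_compose_fps (fls_X_inv ^ Suc n) X =
      fls_X_inv * fls_compose_fps (fls_X_inv ^ n) X + fls_const b * fls_compose_fps (fls_X_inv ^ n) X"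
    using compose_X_inv by (simp only: power_Suc compose.hom_mult mult.assoc[symmetric]) (simp add: algebra_simps)
  then have "a * fls_nth (fls_compose_fps (fls_X_inv ^ Suc n) X) k =
      fls_nth (fls_X_inv * fls_compose_fps (fls_X_inv ^ n) X) k +
      b * fls_nth (fls_compose_fps (fls_X_inv ^ n) X) k"
    by (metis fls_mult_const_nth(1) fls_plus_nth)
  also have "\<dots> = 0"
    using Suc by (simp add: fls_X_inv_times_conv_shift)
  finally show ?case using a by simp
qed (simp add: compose.hom_1)

text \<open>This is the invariance of the residue up to the factor a. Nonnegative powers of z stay
  polynomial in z, w contributes its leading coefficient a, and higher powers of w start too
  late.\<close>

lemma compose_nth_1: "fls_nth (fls_compose_fps f X) 1 = a * fls_nth f 1"
proof -
  have *: "fls_nth (fls_compose_fps (fls_X_inv ^ n * fps_to_fls g) X) 1 =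
      a * fls_nth (fls_X_inv ^ n * fps_to_fls g) 1" for n g
  proof (induction n arbitrary: g)
    case 0
    have "fps_nth (g oo X) 1 = a * fps_nth g 1"
      using mobius_nth_0 mobius_nth_1 by (simp add: fps_compose_nth)
    then show ?case using mobius_nth_0 mobius_nonzero by simp
  next
    case (Suc n)
    \<comment> \<open>Splitting off the constant term of \<open>g\<close> leaves a pure power of z
      and a remainder with one power of z less, to which the induction hypothesis applies.\<close>
    have "g = fps_const (fps_nth g 0) + fps_X * fps_shift 1 g"
      by (rule fps_ext) simp
    then have "fls_X_inv ^ Suc n * fps_to_fls g =
        fls_const (fps_nth g 0) * fls_X_inv ^ Suc n + (fls_X_inv * fls_X) * (fls_X_inv ^ n * fps_to_fls (fps_shift 1 g))"
      by (metis (no_types, lifting) fps_const_to_fls fps_to_fls_plus fps_X_to_fls fls_times_fps_to_fls distrib_left mult.commute mult.left_commute power_Suc)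
    then have eq: "fls_X_inv ^ Suc n * fps_to_fls g =
        fls_const (fps_nth g 0) * fls_X_inv ^ Suc n + fls_X_inv ^ n * fps_to_fls (fps_shift 1 g)"
      by (simp only: mult.commute[of fls_X_inv fls_X] fls_X_times_X_inv mult_1_left)
    have "fls_nth (fls_X_inv ^ Suc n :: complex fls) 1 = 0"
      by (simp del: power_Suc)
    then show ?case
      unfolding eq compose.hom_add compose.hom_mult fls_compose_fps_const
      using Suc.IH[of "fps_shift 1 g"] compose_X_inv_power_nth[of 1 "Suc n"]
      by (simp add: compose.hom_mult)
  qed
  have "int (nat (- fls_subdegree f)) \<ge> - fls_subdegree f" by simp
  then obtain g where "f = fls_shift (int (nat (- fls_subdegree f))) (fps_to_fls g)"
    by (rule fls_as_fps)
  then obtain n where "f = fls_X_inv ^ n * fps_to_fls g"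
    by (metis fls_X_inv_power_times_conv_shift(1))
  then show ?thesis using *[of n g] by simp
qed

end

section \<open>Transporting the bilinear identity\<close>

text \<open>The matrix of the change of variables in the times \<open>t\<^sub>k = p\<^sub>k / k\<close>.\<close>

definition time_coeff :: "complex fps \<Rightarrow> nat \<Rightarrow> nat \<Rightarrow> complex" where
  "time_coeff X i j = of_nat (Suc j) / of_nat (Suc i) * fps_nth (X ^ Suc i) (Suc j)"

lemma time_coeff_eq_0: "fps_nth X 0 = 0 \<Longrightarrow> j < i \<Longrightarrow> time_coeff X i j = 0"
  by (simp add: time_coeff_def startsby_zero_power_prefix del: power_Suc)

lemma time_coeff_nonzeroD: "fps_nth X 0 = 0 \<Longrightarrow> time_coeff X i j \<noteq> 0 \<Longrightarrow> i \<le> j"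
  using time_coeff_eq_0 not_less by blast

definition time_change :: "complex fps \<Rightarrow> nat \<Rightarrow> (nat, complex) mfps" where
  "time_change X i = mfps_linear (time_coeff X i)"

lemma mfps_substitutable_time_change:
  assumes "fps_nth X 0 = 0"
  shows "mfps_substitutable (time_change X)"
  unfolding time_change_def
proof (rule mfps_substitutable_linear)
  fix j
  have "{i. time_coeff X i j \<noteq> 0} \<subseteq> {..j}"
    using time_coeff_nonzeroD[OF assms] by auto
  then show "finite {i. time_coeff X i j \<noteq> 0}" by (rule finite_subset) simp
qed

text \<open>A block diagonal matrix: t and t' undergo the same change without mixing.\<close>

definition two_time_coeff :: "complex fps \<Rightarrow> nat + nat \<Rightarrow> nat + nat \<Rightarrow> complex" where
  "two_time_coeff X v w = (case (v, w) of
      (Inl i, Inl j) \<Rightarrow> time_coeff X i j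
    | (Inr i, Inr j) \<Rightarrow> time_coeff X i j
    | _ \<Rightarrow> 0)"

lemma two_time_coeff_simps [simp]:
  "two_time_coeff X (Inl i) (Inl j) = time_coeff X i j"
  "two_time_coeff X (Inr i) (Inr j) = time_coeff X i j"
  "two_time_coeff X (Inl i) (Inr j) = 0"
  "two_time_coeff X (Inr i) (Inl j) = 0"
  by (simp_all add: two_time_coeff_def)

definition two_time_change :: "complex fps \<Rightarrow> nat + nat \<Rightarrow> (nat + nat, complex) mfps" where
  "two_time_change X v = mfps_linear (two_time_coeff X v)"

text \<open>By triangularity of \<open>time_coeff\<close>, a finite set covering the nonzero rows of
  column w.\<close>

definition two_time_column :: "nat + nat \<Rightarrow> (nat + nat) set" where
  "two_time_column w = (case w of Inl j \<Rightarrow> Inl ` {..j} | Inr j \<Rightarrow> Inr ` {..j})"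

lemma finite_two_time_column: "finite (two_time_column w)"
  by (simp add: two_time_column_def split: sum.split)

lemma two_time_coeff_column:
  assumes "fps_nth X 0 = 0"
  shows "{v. two_time_coeff X v w \<noteq> 0} \<subseteq> two_time_column w"
proof
  fix v assume "v \<in> {v. two_time_coeff X v w \<noteq> 0}"
  then show "v \<in> two_time_column w"
    using time_coeff_nonzeroD[OF assms] by (cases v; cases w) (auto simp: two_time_column_def)
qed

lemma mfps_substitutable_two_time_change:
  assumes "fps_nth X 0 = 0"
  shows "mfps_substitutable (two_time_change X)"
  unfolding two_time_change_def
  by (intro mfps_substitutable_linear finite_subset[OF two_time_coeff_column[OF assms]]
      finite_two_time_column)

text \<open>The effect on integrands of changing both sets of times while replacing w by X(w). Being
  multiplicative, it can be applied factor by factor to the bilinear identity.\<close>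

definition transport ::
    "complex fps \<Rightarrow> (nat + nat, complex fls) mfps \<Rightarrow> (nat + nat, complex fls) mfps" where
  "transport X F = mfps_subst (\<lambda>v. mfps_map fls_const (two_time_change X v))
     (mfps_map (\<lambda>f. fls_compose_fps f X) F)"

text \<open>Treats both shifts at once: \<open>Inl\<close> with sign -1 gives the one in t,
  \<open>Inr\<close> with sign 1 the one in t'.\<close>

definition shift_var :: "(nat \<Rightarrow> 'v) \<Rightarrow> complex \<Rightarrow> nat \<Rightarrow> ('v option, complex) mfps" where
  "shift_var e \<epsilon> i =
     mfps_var (Some (e i)) + mfps_const (\<epsilon> / of_nat (Suc i)) * mfps_var None ^ Suc i"

lemma mfps_nth_shift_var:
  "mfps_nth (shift_var e \<epsilon> i) \<nu> = (if \<nu> = {#Some (e i)#} then 1 else 0) +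
     (if \<nu> = replicate_mset (Suc i) None then \<epsilon> / of_nat (Suc i) else 0)"
  by (simp add: shift_var_def mfps_nth_var mfps_nth_var_power del: power_Suc of_nat_Suc replicate_mset_Suc)

lemma shift_var_support:
  assumes "inj e"
  shows "finite {i. mfps_nth (shift_var e \<epsilon> i) \<nu> \<noteq> 0}"
proof (rule finite_subset)
  show "{i. mfps_nth (shift_var e \<epsilon> i) \<nu> \<noteq> 0} \<subseteq> {i. Some (e i) \<in># \<nu>} \<union> {size \<nu> - 1}"
    by (auto simp: mfps_nth_shift_var split: if_splits)
  have "{i. Some (e i) \<in># \<nu>} = (\<lambda>i. Some (e i)) -` set_mset \<nu>" by auto
  then show "finite ({i. Some (e i) \<in># \<nu>} \<union> {size \<nu> - 1})"
    using assms by (auto intro!: finite_vimageI simp: inj_def)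
qed

lemma mfps_substitutable_shift_var: "inj e \<Longrightarrow> mfps_substitutable (shift_var e \<epsilon>)"
  unfolding mfps_substitutable_def by (auto intro: shift_var_support) (simp add: mfps_nth_shift_var)

lemma kp_shift_minus_eq: "kp_shift_minus \<tau> = collect_w (mfps_subst (shift_var Inl (- 1)) \<tau>)"
proof -
  have "(\<lambda>i. mfps_var (Some (Inl i)) - mfps_const (1 / of_nat (Suc i)) * mfps_var None ^ Suc i) =
      (shift_var Inl (- 1) :: nat \<Rightarrow> ((nat + nat) option, complex) mfps)"
    by (rule ext, rule mfps_eqI) (simp add: shift_var_def del: power_Suc of_nat_Suc)
  then show ?thesis by (simp only: kp_shift_minus_def)
qed

lemma kp_shift_plus_eq: "kp_shift_plus \<tau> = collect_w (mfps_subst (shift_var Inr 1) \<tau>)"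
  by (simp add: kp_shift_plus_def shift_var_def[abs_def])

text \<open>
  Since \<open>p\<^sub>k\<close> evaluated at \<open>q\<^sub>m - w\<^sup>m\<close> is \<open>p\<^sub>k(q) - X(w)\<^sup>k\<close>, the shift by \<open>w\<close> in the
  new variables is the shift by \<open>X(w)\<close> in the old ones.
\<close>

lemma shift_var_change:
  assumes e: "inj e" and X: "fps_nth X 0 = 0"
    and T: "\<And>i j. two_time_coeff X (e i) (e j) = time_coeff X i j"
      "\<And>i w. w \<notin> range e \<Longrightarrow> two_time_coeff X (e i) w = 0"
  shows "mfps_subst (shift_var e \<epsilon>) (time_change X i) =
    mfps_subst (w_subst (two_time_change X) X) (shift_var e \<epsilon> i)"
proof (rule w_coeff_eqI)
  fix \<mu> n
  define \<nu> where "\<nu> = image_mset Some \<mu> + replicate_mset n (None :: (nat + nat) option)"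
  define U where "U = w_subst (two_time_change X) X"
  have nth_\<nu>: "mfps_nth F \<nu> = fps_nth (w_coeff F \<mu>) n" for F :: "((nat + nat) option, complex) mfps"
    by (simp add: w_coeff_def \<nu>_def)
  note sU = mfps_substitutable_w_subst[OF mfps_substitutable_two_time_change[OF X] X, folded U_def]
  note sS = mfps_substitutable_shift_var[OF e, of \<epsilon>]
  have rhs: "mfps_nth (mfps_subst U (shift_var e \<epsilon> i)) \<nu> =
      (if n = 0 then mfps_nth (two_time_change X (e i)) \<mu> else 0) +
      \<epsilon> / of_nat (Suc i) * (if \<mu> = {#} then fps_nth (X ^ Suc i) n else 0)"
  proof -
    have "mfps_subst U (shift_var e \<epsilon> i) =
        U (Some (e i)) + mfps_const (\<epsilon> / of_nat (Suc i)) * U None ^ Suc i"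
      unfolding shift_var_def
      by (simp only: mfps_subst_add[OF sU] mfps_subst_mult[OF sU] mfps_subst_power[OF sU]
          mfps_subst_var[OF sU] mfps_subst_const[OF sU])
    moreover have "mfps_nth (U (Some (e i))) \<nu> = (if n = 0 then mfps_nth (two_time_change X (e i)) \<mu> else 0)"
      unfolding nth_\<nu> U_def w_coeff_w_subst_Some by simp
    moreover have "mfps_nth (U None ^ Suc i) \<nu> = (if \<mu> = {#} then fps_nth (X ^ Suc i) n else 0)"
      unfolding nth_\<nu> U_def w_coeff_w_subst_None_power by simp
    ultimately show ?thesis by (simp del: power_Suc of_nat_Suc)
  qed
  have lhs: "mfps_nth (mfps_subst (shift_var e \<epsilon>) (time_change X i)) \<nu> =
      (\<Sum>j\<in>A. time_coeff X i j * mfps_nth (shift_var e \<epsilon> j) \<nu>)"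
    if "finite A" "{j. mfps_nth (shift_var e \<epsilon> j) \<nu> \<noteq> 0} \<subseteq> A" for A
    unfolding time_change_def by (rule mfps_subst_linear[OF sS that])
  have "mfps_nth (mfps_subst (shift_var e \<epsilon>) (time_change X i)) \<nu> =
      mfps_nth (mfps_subst U (shift_var e \<epsilon> i)) \<nu>"
  proof -
    \<comment> \<open>Both sides involve only single times and pure positive powers of w, so only
      the first two cases carry nonzero coefficients.\<close>
    consider (t) w where "\<mu> = {#w#}" "n = 0" | (w) m where "\<mu> = {#}" "n = Suc m"
      | (0) "\<mu> = {#}" "n = 0" | (other) "size \<mu> + n \<ge> 2" "\<mu> \<noteq> {#}"
    proof (cases "\<mu> = {#}")
      case True
      then show ?thesis using that(2,3) by (cases n) auto
    next
      case False
      then have "size \<mu> \<ge> 1" by (simp add: Suc_le_eq nonempty_has_size)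
      show ?thesis
      proof (cases "size \<mu> = 1 \<and> n = 0")
        case True
        then show ?thesis using that(1) size_1_singleton_mset by blast
      next
        assume "\<not> (size \<mu> = 1 \<and> n = 0)"
        then show ?thesis using that(4) False \<open>size \<mu> \<ge> 1\<close> by linarith
      qed
    qed
    then show ?thesis
    proof cases
      case t
      then have \<nu>: "\<nu> = {#Some w#}" by (simp add: \<nu>_def)
      have nth: "mfps_nth (shift_var e \<epsilon> j) \<nu> = (if w = e j then 1 else 0)" for j
        by (auto simp: mfps_nth_shift_var \<nu>)
      have rhs': "mfps_nth (mfps_subst U (shift_var e \<epsilon> i)) \<nu> = two_time_coeff X (e i) w"
        unfolding rhs using t by (simp add: two_time_change_def)
      show ?thesis
      proof (cases "w \<in> range e")
        case True
        then obtain k where "w = e k" by blast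
        then show ?thesis
          unfolding rhs' using T e by (subst lhs[of "{k}"]) (auto simp: nth inj_eq)
      next
        case False
        then show ?thesis
          unfolding rhs' using T by (subst lhs[of "{}"]) (auto simp: nth)
      qed
    next
      case w
      then have \<nu>: "\<nu> = replicate_mset (Suc m) None" by (simp add: \<nu>_def)
      have nth: "mfps_nth (shift_var e \<epsilon> j) \<nu> = (if m = j then \<epsilon> / of_nat (Suc j) else 0)" for j
      proof -
        have "\<nu> \<noteq> {#Some (e j)#}" unfolding \<nu> by simp
        moreover have "\<nu> = replicate_mset (Suc j) None \<longleftrightarrow> m = j"
          unfolding \<nu> by (metis nat.inject size_replicate_mset)
        ultimately show ?thesis by (simp add: mfps_nth_shift_var)
      qed
      have "mfps_nth (mfps_subst (shift_var e \<epsilon>) (time_change X i)) \<nu> =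
          time_coeff X i m * (\<epsilon> / of_nat (Suc m))"
        by (subst lhs[of "{m}"]) (auto simp: nth)
      \<comment> \<open>The factor (m + 1) / (i + 1) in \<open>time_coeff\<close> exchanges the
        denominator of the shift of the new time for that of the old one.\<close>
      also have "\<dots> = \<epsilon> / of_nat (Suc i) * fps_nth (X ^ Suc i) (Suc m)"
        unfolding time_coeff_def using of_nat_neq_0[of m, where 'a = complex]
        by (simp add: field_simps del: of_nat_Suc power_Suc)
      finally show ?thesis unfolding rhs using w by (simp del: of_nat_Suc power_Suc)
    next
      case 0
      then show ?thesis
        unfolding rhs using X
        by (subst lhs[of "{}"]) (auto simp: mfps_nth_shift_var \<nu>_def two_time_change_def mfps_nth_linear_size)
    next
      case other
      have "size \<nu> \<ge> 2" using other by (simp add: \<nu>_def)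
      then have "\<nu> \<noteq> {#Some (e j)#}" for j by auto
      moreover have "\<nu> \<noteq> replicate_mset (Suc j) None" for j
      proof -
        have "some_part \<nu> \<noteq> {#}" using other by (simp add: \<nu>_def)
        then show ?thesis by (metis some_part_replicate_None)
      qed
      moreover have "n = 0 \<Longrightarrow> mfps_nth (two_time_change X (e i)) \<mu> = 0"
        using other by (simp add: two_time_change_def mfps_nth_linear_size)
      ultimately show ?thesis
        unfolding rhs using other by (subst lhs[of "{}"]) (auto simp: mfps_nth_shift_var)
    qed
  qed
  then show "fps_nth (w_coeff (mfps_subst (shift_var e \<epsilon>) (time_change X i)) \<mu>) n =
      fps_nth (w_coeff (mfps_subst (w_subst (two_time_change X) X) (shift_var e \<epsilon> i)) \<mu>) n"
    by (simp add: w_coeff_def \<nu>_def U_def)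
qed

section \<open>Transport of the shifted series, of the exponential factor and of the residue\<close>

context mobius_change
begin

text \<open>The two composite substitutions agree on every variable by
  \<open>shift_var_change\<close>; \<open>collect_w_subst\<close> then turns the combined change
  into \<open>transport\<close>.\<close>

lemma collect_shift_time_change:
  assumes e: "inj e"
    and T: "\<And>i j. two_time_coeff X (e i) (e j) = time_coeff X i j"
      "\<And>i w. w \<notin> range e \<Longrightarrow> two_time_coeff X (e i) w = 0"
  shows "collect_w (mfps_subst (shift_var e \<epsilon>) (mfps_subst (time_change X) \<tau>)) =
    transport X (collect_w (mfps_subst (shift_var e \<epsilon>) \<tau>))"
proof -
  note X0 = mobius_nth_0
  note s = mfps_substitutable_shift_var[OF e, of \<epsilon>]
    mfps_substitutable_time_change[OF X0] mfps_substitutable_two_time_change[OF X0]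
  have "mfps_subst (shift_var e \<epsilon>) (mfps_subst (time_change X) \<tau>) =
      mfps_subst (\<lambda>i. mfps_subst (w_subst (two_time_change X) X) (shift_var e \<epsilon> i)) \<tau>"
    by (simp add: mfps_subst_subst s shift_var_change[OF e X0 T])
  also have "\<dots> = mfps_subst (w_subst (two_time_change X) X) (mfps_subst (shift_var e \<epsilon>) \<tau>)"
    by (simp add: mfps_subst_subst s mfps_substitutable_w_subst X0)
  finally show ?thesis
    by (simp add: collect_w_subst s X0 mobius_nonzero transport_def)
qed

lemma mfps_substitutable_transport:
  "mfps_substitutable (\<lambda>v. mfps_map fls_const (two_time_change X v))"
  by (intro fls_const.mfps_substitutable_map mfps_substitutable_two_time_change mobius_nth_0)

lemma transport_mult: "transport X (F * G) = transport X F * transport X G"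
  by (simp add: transport_def compose.mfps_map_mult mfps_subst_mult mfps_substitutable_transport)

text \<open>With y = 1/X(w), the left side is j + 1 times the coefficient of s^(j+1) in - ln (1 - y
  X(s)), so \<open>deriv_log_compose\<close> evaluates it. It is the coefficient of the time with
  index j in the transported exponent.\<close>

lemma exponent_transform:
  "(\<Sum>i\<le>j. fls_compose_fps (fls_X_inv ^ Suc i) X * fls_const (time_coeff X i j)) =
    fls_X_inv ^ Suc j + fls_const (b * (- b) ^ j)"
proof -
  define y where "y = fls_compose_fps fls_X_inv X"
  \<comment> \<open>X as a series in s over Laurent series in w: s stays independent of the w hidden
    in the coefficient y.\<close>
  define Y where "Y = Abs_fps (\<lambda>n. fls_const (fps_nth X n))"
  define H where "H = Abs_fps (\<lambda>k. y ^ k / of_nat k)"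
  have const_sum: "fls_const (sum f A) = (\<Sum>x\<in>A. fls_const (f x))" for f :: "nat \<Rightarrow> complex" and A
    by (rule fls_const.hom_sum)
  have embed: "Abs_fps (\<lambda>n. fls_const (fps_nth (F * G) n)) =
      Abs_fps (\<lambda>n. fls_const (fps_nth F n)) * Abs_fps (\<lambda>n. fls_const (fps_nth G n))" for F G :: "complex fps"
    by (rule fps_ext) (simp add: fps_mult_nth const_sum fls_const_mult_const)
  have Y_power: "Y ^ k = Abs_fps (\<lambda>n. fls_const (fps_nth (X ^ k) n))" for k
  proof (induction k)
    case 0
    show ?case by (rule fps_ext) simp
  next
    case (Suc k)
    then show ?case by (simp add: Y_def embed)
  qed
  have "Abs_fps (\<lambda>n. fls_const (fps_nth (X * (1 + fps_const b * fps_X)) n)) =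
      Abs_fps (\<lambda>n. fls_const (fps_nth (fps_const a * fps_X) n))"
    by (simp only: X_eq)
  moreover have "Abs_fps (\<lambda>n. fls_const (fps_nth (1 + fps_const b * fps_X) n)) =
      1 + fps_const (fls_const b) * fps_X"
    by (rule fps_ext) (simp add: fps_X_def)
  moreover have "Abs_fps (\<lambda>n. fls_const (fps_nth (fps_const a * fps_X) n)) =
      fps_const (fls_const a) * fps_X"
    by (rule fps_ext) (simp add: fps_X_def)
  ultimately have "Y * (1 + fps_const (fls_const b) * fps_X) = fps_const (fls_const a) * fps_X"
    by (simp only: embed Y_def)
  then have deriv: "fps_deriv (H oo Y) =
      Abs_fps (\<lambda>j. fls_X_inv ^ Suc j + fls_const b * (- fls_const b) ^ j)"
    unfolding H_def
    by (rule deriv_log_compose) (use compose_X_inv mobius_nth_0 in \<open>simp_all add: Y_def y_def\<close>)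
  \<comment> \<open>Of the factor (j + 1) / (i + 1) in \<open>time_coeff\<close>, the denominator
    belongs to the logarithm and the numerator to differentiation in s.\<close>
  have coeff: "fls_compose_fps (fls_X_inv ^ Suc i) X * fls_const (time_coeff X i j) =
      of_nat (Suc j) * (fps_nth H (Suc i) * fps_nth (Y ^ Suc i) (Suc j))" for i
  proof -
    have "of_nat (Suc i) * fls_const (time_coeff X i j) = fls_const (of_nat (Suc i) * time_coeff X i j)"
      by (simp only: fls_const.hom_mult fls_const.hom_of_nat)
    also have "of_nat (Suc i) * time_coeff X i j = of_nat (Suc j) * fps_nth (X ^ Suc i) (Suc j)"
      using of_nat_neq_0[of i, where 'a = complex] by (simp add: time_coeff_def del: of_nat_Suc power_Suc)
    finally have "of_nat (Suc i) * fls_const (time_coeff X i j) =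
        of_nat (Suc j) * fps_nth (Y ^ Suc i) (Suc j)"
      by (simp only: fls_const.hom_mult fls_const.hom_of_nat Y_power fps_nth_Abs_fps)
    then have "fls_const (time_coeff X i j) = of_nat (Suc j) * fps_nth (Y ^ Suc i) (Suc j) / of_nat (Suc i)"
      using of_nat_neq_0[of i, where 'a = "complex fls"] by (simp add: field_simps del: of_nat_Suc power_Suc)
    then show ?thesis
      by (simp only: compose.hom_power y_def[symmetric] H_def fps_nth_Abs_fps) (simp only: times_divide_eq_left times_divide_eq_right mult_ac)
  qed
  have "(\<Sum>i\<le>j. fls_compose_fps (fls_X_inv ^ Suc i) X * fls_const (time_coeff X i j)) =
      of_nat (Suc j) * (\<Sum>i\<le>j. fps_nth H (Suc i) * fps_nth (Y ^ Suc i) (Suc j))"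
    by (simp only: coeff sum_distrib_left)
  also have "(\<Sum>i\<le>j. fps_nth H (Suc i) * fps_nth (Y ^ Suc i) (Suc j)) = fps_nth (H oo Y) (Suc j)"
    unfolding fps_compose_nth
    by (subst sum.atLeast0_atMost_Suc_shift) (simp add: H_def atLeast0AtMost)
  also have "of_nat (Suc j) * \<dots> = fps_nth (fps_deriv (H oo Y)) j"
    by simp
  also have "\<dots> = fls_X_inv ^ Suc j + fls_const (b * (- b) ^ j)"
    unfolding deriv by (simp only: fps_nth_Abs_fps fls_const.hom_mult fls_const.hom_power fls_const.hom_minus)
  finally show ?thesis .
qed

text \<open>The numbers b (-b)^j are the coefficients of the derivative of ln (1 + b s). They are
  free of z, so the exponential of this form acts as a constant under the residue.\<close>

definition exponent_shift :: "nat + nat \<Rightarrow> complex" where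
  "exponent_shift v = (case v of Inl j \<Rightarrow> b * (- b) ^ j | Inr j \<Rightarrow> - (b * (- b) ^ j))"

lemma transport_kp_exp:
  "transport X kp_exp = kp_exp * mfps_map fls_const (mfps_exp0 (mfps_linear exponent_shift))"
proof -
  define f :: "nat + nat \<Rightarrow> complex fls" where
    "f v = (case v of Inl i \<Rightarrow> fls_X_inv ^ Suc i | Inr i \<Rightarrow> - (fls_X_inv ^ Suc i))" for v
  have kp: "kp_exp = mfps_exp0 (mfps_linear f)"
    by (simp add: kp_exp_def f_def[abs_def])
  have "transport X kp_exp = mfps_exp0 (mfps_subst (\<lambda>v. mfps_map fls_const (two_time_change X v))
      (mfps_linear (\<lambda>v. fls_compose_fps (f v) X)))"
    by (simp add: transport_def kp mfps_map_exp0 compose.coeff_hom_axioms compose.mfps_map_linear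
        mfps_subst_exp0 mfps_substitutable_transport del: One_nat_def)
  also have "mfps_subst (\<lambda>v. mfps_map fls_const (two_time_change X v))
      (mfps_linear (\<lambda>v. fls_compose_fps (f v) X)) =
      mfps_linear (\<lambda>w. \<Sum>v\<in>two_time_column w. fls_compose_fps (f v) X * fls_const (two_time_coeff X v w))"
    unfolding two_time_change_def fls_const.mfps_map_linear
  proof (rule mfps_subst_linear_linear)
    show "mfps_substitutable (\<lambda>v. mfps_linear (\<lambda>w. fls_const (two_time_coeff X v w)))"
      using mfps_substitutable_transport unfolding two_time_change_def fls_const.mfps_map_linear .
    show "{v. fls_const (two_time_coeff X v w) \<noteq> 0} \<subseteq> two_time_column w" for w
      using two_time_coeff_column[OF mobius_nth_0] by simp
  qed (rule finite_two_time_column)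
  also have "(\<lambda>w. \<Sum>v\<in>two_time_column w. fls_compose_fps (f v) X * fls_const (two_time_coeff X v w)) =
      (\<lambda>w. f w + fls_const (exponent_shift w))"
  proof
    fix w
    show "(\<Sum>v\<in>two_time_column w. fls_compose_fps (f v) X * fls_const (two_time_coeff X v w)) =
        f w + fls_const (exponent_shift w)"
    proof (cases w)
      case (Inl j)
      then show ?thesis
        using exponent_transform[of j]
        by (simp add: two_time_column_def sum.reindex f_def exponent_shift_def o_def del: power_Suc)
    next
      case (Inr j)
      then show ?thesis
        using arg_cong[OF exponent_transform[of j], of uminus]
        by (simp add: two_time_column_def sum.reindex f_def exponent_shift_def o_def
            compose.hom_minus fls_const.hom_minus del: power_Suc flip: sum_negf)
    qed
  qed
  also have "mfps_exp0 (mfps_linear (\<lambda>w. f w + fls_const (exponent_shift w))) =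
      kp_exp * mfps_exp0 (mfps_linear (\<lambda>w. fls_const (exponent_shift w)))"
    unfolding kp mfps_linear_add by (intro mfps_exp0_add mfps_order_ge_linear)
  finally show ?thesis
    by (simp add: mfps_map_exp0 fls_const.coeff_hom_axioms fls_const.mfps_map_linear)
qed

text \<open>\<open>transport_kp_exp\<close> solved for \<open>kp_exp\<close>: the extra factor is
  inverted by changing the sign of its exponent.\<close>

lemma kp_exp_transport:
  "kp_exp = mfps_map fls_const (mfps_exp0 (- mfps_linear exponent_shift)) * transport X kp_exp"
proof -
  let ?L = "mfps_linear exponent_shift"
  have "mfps_exp0 (?L + - ?L) = mfps_exp0 ?L * mfps_exp0 (- ?L)"
    unfolding mfps_linear_minus[symmetric] by (intro mfps_exp0_add mfps_order_ge_linear)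
  moreover have "mfps_exp0 0 = (1 :: (nat + nat, complex) mfps)"
  proof (rule mfps_eqI)
    fix \<mu> :: "(nat + nat) multiset"
    show "mfps_nth (mfps_exp0 0) \<mu> = mfps_nth (1 :: (nat + nat, complex) mfps) \<mu>"
      unfolding mfps_exp0_def mfps_nth_Abs
      by (subst sum.atMost_shift) (simp add: mfps_nth_one)
  qed
  ultimately have "mfps_exp0 (- ?L) * mfps_exp0 ?L = 1" by (simp add: mult.commute)
  then have "mfps_map fls_const (mfps_exp0 (- ?L)) * mfps_map fls_const (mfps_exp0 ?L) = 1"
    by (simp flip: fls_const.mfps_map_mult add: fls_const.mfps_map_1)
  then show ?thesis
    unfolding transport_kp_exp by (metis mult.assoc mult.commute mult_1_left)
qed

text \<open>A coefficient of the product is a finite combination, with scalars free of w, of the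
  coefficients of \<open>K\<close> composed with X; by \<open>compose_nth_1\<close> composition
  multiplies their residues by a.\<close>

lemma residue_transport:
  assumes "\<And>\<mu>. residue_infinity (mfps_nth K \<mu>) = 0"
  shows "residue_infinity (mfps_nth (mfps_map fls_const E * transport X K) \<mu>) = 0"
proof -
  have sum1: "fls_nth (sum f A) 1 = (\<Sum>x\<in>A. fls_nth (f x) 1)" for f :: "'x \<Rightarrow> complex fls" and A
    by (induction A rule: infinite_finite_induct) auto
  have K: "fls_nth (mfps_nth K \<alpha>) 1 = 0" for \<alpha>
    using assms[of \<alpha>] by (simp add: residue_infinity_eq)
  have "fls_nth (mfps_nth (transport X K) \<alpha>) 1 = 0" for \<alpha>
    unfolding transport_def mfps_nth_subst_support[OF mfps_substitutable_transport] sum1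
  proof (rule sum.neutral, rule ballI)
    fix l
    show "fls_nth (mfps_nth (mfps_map (\<lambda>f. fls_compose_fps f X) K) l *
        mfps_nth (\<Prod>v\<in>#l. mfps_map fls_const (two_time_change X v)) \<alpha>) 1 = 0"
      using compose_nth_1[of "mfps_nth K l"] K[of l] by (simp flip: fls_const.mfps_map_prod_mset)
  qed
  then show ?thesis
    unfolding residue_infinity_eq mfps_nth_mult sum1 by simp
qed

text \<open>The shifted series are transported exactly and \<open>kp_exp\<close> up to a factor free
  of z, so the new integrand is that factor times the transported old one.\<close>

lemma kp_tau_time_change:
  assumes "kp_tau \<tau>"
  shows "kp_tau (mfps_subst (time_change X) \<tau>)"
  unfolding kp_tau_def
proof
  fix \<mu>
  let ?\<tau> = "mfps_subst (time_change X) \<tau>"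
  have "kp_shift_minus ?\<tau> = transport X (kp_shift_minus \<tau>)"
    unfolding kp_shift_minus_eq by (rule collect_shift_time_change) (auto simp: two_time_coeff_def split: sum.splits)
  moreover have "kp_shift_plus ?\<tau> = transport X (kp_shift_plus \<tau>)"
    unfolding kp_shift_plus_eq by (rule collect_shift_time_change) (auto simp: two_time_coeff_def split: sum.splits)
  ultimately have "kp_exp * kp_shift_minus ?\<tau> * kp_shift_plus ?\<tau> =
      mfps_map fls_const (mfps_exp0 (- mfps_linear exponent_shift)) *
      transport X (kp_exp * kp_shift_minus \<tau> * kp_shift_plus \<tau>)"
    using kp_exp_transport by (simp only: transport_mult mult.assoc[symmetric])
  then show "residue_infinity (mfps_nth (kp_exp * kp_shift_minus ?\<tau> * kp_shift_plus ?\<tau>) \<mu>) = 0"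
    using assms by (simp add: residue_transport kp_tau_def)
qed

section \<open>Passage from times to the variables p, and the inverse change\<close>

lemma mfps_substitutable_power_change: "mfps_substitutable (power_change X)"
  unfolding power_change_def
proof (rule mfps_substitutable_linear)
  fix j
  have "{i. fps_nth (X ^ Suc i) (Suc j) \<noteq> 0} \<subseteq> {..j}"
    using startsby_zero_power_prefix[OF mobius_nth_0] by (auto simp: not_less[symmetric] simp del: power_Suc)
  then show "finite {i. fps_nth (X ^ Suc i) (Suc j) \<noteq> 0}" by (rule finite_subset) simp
qed

lemma rescale_eq_linear:
  "mfps_const (of_nat (Suc i)) * mfps_var i =
    (mfps_linear (\<lambda>j. if i = j then of_nat (Suc i) else 0) :: (nat, complex) mfps)"
  by (rule mfps_linear_eqI) (auto simp: mfps_nth_var)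

lemma mfps_substitutable_rescale:
  "mfps_substitutable (\<lambda>i. mfps_const (of_nat (Suc i)) * mfps_var i :: (nat, complex) mfps)"
  unfolding rescale_eq_linear by (rule mfps_substitutable_linear) simp

text \<open>\<open>time_coeff\<close> is the matrix of \<open>power_change\<close> conjugated by the
  rescaling of variables, so the two composites agree on every variable.\<close>

lemma rescale_power_change:
  "mfps_subst (\<lambda>i. mfps_const (of_nat (Suc i)) * mfps_var i) (mfps_subst (power_change X) F) =
    mfps_subst (time_change X) (mfps_subst (\<lambda>i. mfps_const (of_nat (Suc i)) * mfps_var i) F)"
proof -
  note s = mfps_substitutable_rescale mfps_substitutable_power_change
    mfps_substitutable_time_change[OF mobius_nth_0]
  have "{v. (if v = w then of_nat (Suc v) else (0 :: complex)) \<noteq> 0} \<subseteq> {w}" for w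
    by auto
  then have "mfps_subst (\<lambda>i. mfps_const (of_nat (Suc i)) * mfps_var i) (power_change X i) =
      mfps_linear (\<lambda>j. fps_nth (X ^ Suc i) (Suc j) * of_nat (Suc j))" for i
    using mfps_subst_linear_linear[OF s(1)[unfolded rescale_eq_linear], of "\<lambda>j. {j}"]
    unfolding power_change_def rescale_eq_linear by simp
  moreover have "mfps_subst (time_change X) (mfps_const (of_nat (Suc i)) * mfps_var i) =
      mfps_linear (\<lambda>j. fps_nth (X ^ Suc i) (Suc j) * of_nat (Suc j))" for i
  proof -
    have "mfps_subst (time_change X) (mfps_const (of_nat (Suc i)) * mfps_var i) =
        mfps_const (of_nat (Suc i)) * time_change X i"
      by (simp only: mfps_subst_mult[OF s(3)] mfps_subst_const[OF s(3)] mfps_subst_var[OF s(3)])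
    also have "\<dots> = mfps_linear (\<lambda>j. fps_nth (X ^ Suc i) (Suc j) * of_nat (Suc j))"
      using of_nat_neq_0[of i, where 'a = complex]
      by (intro mfps_linear_eqI)
         (simp_all add: time_change_def mfps_nth_linear_size time_coeff_def mult.commute del: of_nat_Suc power_Suc)
    finally show ?thesis .
  qed
  ultimately show ?thesis by (simp only: mfps_subst_subst s)
qed

lemma kp_solution_power_change:
  assumes "kp_solution \<Phi>"
  shows "kp_solution (mfps_subst (power_change X) \<Phi>)"
proof -
  have "mfps_exp (mfps_subst (power_change X) \<Phi>) = mfps_subst (power_change X) (mfps_exp \<Phi>)"
    by (simp add: mfps_subst_exp mfps_substitutable_power_change)
  then show ?thesis
    using assms unfolding kp_solution_def by (simp only: rescale_power_change kp_tau_time_change)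
qed

text \<open>The matrices of \<open>power_change\<close> are Carleman matrices: their product is the
  matrix of the composite series, here the identity.\<close>

lemma power_change_compose_inverse:
  assumes Y: "mobius_change a' b' Y" and inv: "Y oo X = fps_X"
  shows "mfps_subst (power_change X) (mfps_subst (power_change Y) F) = F"
proof -
  note sX = mfps_substitutable_power_change
  have *: "mfps_subst (power_change X) (power_change Y i) = mfps_var i" for i
  proof -
    have "mfps_subst (power_change X) (power_change Y i) =
        mfps_linear (\<lambda>j. \<Sum>k\<le>j. fps_nth (Y ^ Suc i) (Suc k) * fps_nth (X ^ Suc k) (Suc j))"
      unfolding power_change_def
    proof (rule mfps_subst_linear_linear)
      show "{v. fps_nth (X ^ Suc v) (Suc w) \<noteq> 0} \<subseteq> {..w}" for w
        using startsby_zero_power_prefix[OF mobius_nth_0]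
        by (auto simp: not_less[symmetric] simp del: power_Suc)
    qed (use sX in \<open>simp_all add: power_change_def[abs_def]\<close>)
    also have "\<dots> = mfps_linear (\<lambda>j. if j = i then 1 else 0)"
    proof (intro arg_cong[of _ _ mfps_linear] ext)
      fix j
      \<comment> \<open>Composition also sums over exponent 0, to which no variable corresponds;
        that term vanishes.\<close>
      have "fps_nth (Y ^ Suc i) 0 = 0"
        using mobius_change.mobius_nth_0[OF Y] by simp
      then have "(\<Sum>k\<le>j. fps_nth (Y ^ Suc i) (Suc k) * fps_nth (X ^ Suc k) (Suc j)) =
          fps_nth (Y ^ Suc i oo X) (Suc j)"
        unfolding fps_compose_nth
        by (subst sum.atLeast0_atMost_Suc_shift) (simp add: atLeast0AtMost)
      also have "Y ^ Suc i oo X = fps_X ^ Suc i"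
        using mobius_nth_0 inv by (simp only: fps_compose_power[symmetric])
      finally show "(\<Sum>k\<le>j. fps_nth (Y ^ Suc i) (Suc k) * fps_nth (X ^ Suc k) (Suc j)) =
          (if j = i then 1 else 0)"
        by (simp del: power_Suc)
    qed
    finally show ?thesis by (simp only: mfps_linear_delta)
  qed
  show ?thesis
    by (simp add: mfps_subst_subst[OF sX mobius_change.mfps_substitutable_power_change[OF Y]] * mfps_subst_id)
qed

lemma compose_mobius_inverse:
  assumes Y: "Y * (1 + fps_const (- b / a) * fps_X) = fps_const (1 / a) * fps_X"
  shows "Y oo X = fps_X"
proof -
  have "(Y * (1 + fps_const (- b / a) * fps_X)) oo X = (fps_const (1 / a) * fps_X) oo X"
    by (simp only: Y)
  then have "(Y oo X) * (1 + fps_const (- b / a) * X) = fps_const (1 / a) * X"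
    using mobius_nth_0 by (simp add: fps_compose_mult_distrib fps_compose_add_distrib)
  \<comment> \<open>Multiplying by 1 + b w replaces each X (1 + b w) by a w, so the bracket becomes
    1 + b w - b w = 1.\<close>
  then have "(Y oo X) * ((1 + fps_const b * fps_X) + fps_const (- b / a) * (X * (1 + fps_const b * fps_X))) =
      fps_const (1 / a) * (X * (1 + fps_const b * fps_X))"
    by (metis (no_types, lifting) distrib_right mult.assoc mult_1_left)
  moreover have "(1 + fps_const b * fps_X) + fps_const (- b / a) * (X * (1 + fps_const b * fps_X)) = 1"
    unfolding X_eq mult.assoc[symmetric] using a by simp
  moreover have "fps_const (1 / a) * (X * (1 + fps_const b * fps_X)) = fps_X"
    unfolding X_eq mult.assoc[symmetric] using a by simp
  ultimately show ?thesis by (simp only: mult_1_right)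
qed

end

lemma mobius_change_quotient:
  assumes "a \<noteq> 0"
  shows "mobius_change a b (fps_const a * fps_X / (1 + fps_const b * fps_X))"
proof
  have "is_unit (1 + fps_const b * fps_X)"
    by (simp add: fps_is_unit_iff)
  then show "fps_const a * fps_X / (1 + fps_const b * fps_X) * (1 + fps_const b * fps_X) = fps_const a * fps_X"
    by (rule unit_div_mult_self)
qed fact

theorem corollary3p6:
  fixes a b :: complex and X :: "complex fps"
  assumes "a \<noteq> 0"
    and "X = fps_const a * fps_X / (1 + fps_const b * fps_X)"
  shows "quadratic_correction (power_change X) 0 \<and>
    kp_automorphism (mfps_subst (power_change X))"
proof
  \<comment> \<open>Solving x = a w / (1 + b w) for w gives w = (x/a) / (1 - (b/a) x), again
    fractional linear.\<close>
  define Y where "Y = fps_const (1 / a) * fps_X / (1 + fps_const (- b / a) * fps_X)"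
  interpret X: mobius_change a b X
    unfolding assms(2) using assms(1) by (rule mobius_change_quotient)
  interpret Y: mobius_change "1 / a" "- b / a" Y
    unfolding Y_def using assms(1) by (intro mobius_change_quotient) simp
  have XY: "mfps_subst (power_change X) (mfps_subst (power_change Y) F) = F" for F
    by (intro X.power_change_compose_inverse[OF Y.mobius_change_axioms]
        X.compose_mobius_inverse Y.X_eq)
  \<comment> \<open>Inverting the parameters 1/a and -b/a in the same way returns a and b, so the
    equation of X itself is what is required.\<close>
  have YX: "mfps_subst (power_change Y) (mfps_subst (power_change X) F) = F" for F
    using X.X_eq assms(1)
    by (intro Y.power_change_compose_inverse[OF X.mobius_change_axioms]
        Y.compose_mobius_inverse) simp
  show "quadratic_correction (power_change X) 0"
    by (simp add: quadratic_correction_def quadratic_form_def X.kp_solution_power_change)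
  show "kp_automorphism (mfps_subst (power_change X))"
    unfolding kp_automorphism_def
  proof (intro conjI allI)
    show "bij (mfps_subst (power_change X))"
      by (rule o_bij[of "mfps_subst (power_change Y)"]) (auto simp: XY YX)
    \<comment> \<open>The converse direction applies the change given by Y to the transformed series
      and recovers \<Phi>.\<close>
    show "kp_solution (mfps_subst (power_change X) \<Phi>) \<longleftrightarrow> kp_solution \<Phi>" for \<Phi>
      using X.kp_solution_power_change Y.kp_solution_power_change YX by metis
  qed
qed

end
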